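(* The maximal ideal space of the Banach algebra $A_\tau(\mathbb{T}^\omega)$ coincides with $\mathfrak{D}$: for each point $\mathbf{r}\boldsymbol{\lambda}\in\mathfrak{D}$ (with $\mathbf{r}=\mathbf{p}^{-\sigma}$, $\sigma\in[0,\infty]$, $\boldsymbol{\lambda}\in\mathbb{T}^\omega$), the functional $f\mapsto\int_{\mathbb{T}^\omega}f\,dP_{\mathbf{r},\boldsymbol{\lambda}}$ is a complex homomorphism of $A_\tau(\mathbb{T}^\omega)$, and the resulting map from $\mathfrak{D}$ to the set of all complex homomorphisms of $A_\tau(\mathbb{T}^\omega)$ is a bijection.
   Context: $p_k$ is the $k$-th prime. $\mathbb{Z}^\infty$ is the group of finitely supported integer sequences $\mathbf{n}=(n_1,n_2,\dots)$, $\tau(\mathbf{n})=\sum_k n_k\log p_k$. It is the dual of the compact group $\mathbb{T}^\omega$ (product of countably many circles), via the characters $\gamma_{\mathbf{n}}(\boldsymbol{\lambda})=\prod_k\lambda_k^{n_k}$; Fourier transforms are taken with respect to normalized Haar measure. $A_\tau(\mathbb{T}^\omega)$ is the algebra of all $f\in C(\mathbb{T}^\omega)$ with $\hat f(\mathbf{n})=0$ whenever $\tau(\mathbf{n})<0$, with the uniform norm. A complex homomorphism is a nonzero multiplicative linear functional; the maximal ideal space is the set of these. For $\sigma\in[0,\infty)$, $\mathbf{p}^{-\sigma}=(p_k^{-\sigma})_{k\ge1}$, and $\mathbf{p}^{-\infty}=\mathbf{0}=(0,0,\dots)$. Products of sequences are coordinatewise. $\mathfrak{D}=\{\mathbf{p}^{-\sigma}\boldsymbol{\lambda}:\boldsymbol{\lambda}\in\mathbb{T}^\omega,\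 \sigma\in[0,\infty]\}$ (all points with $\sigma=\infty$ are the single point $\mathbf{0}$). For $\mathbf{r}=\mathbf{p}^{-\sigma}$, the Poisson measure $P_{\mathbf{r}}$ is the unique positive Borel measure on $\mathbb{T}^\omega$ with $\hat P_{\mathbf{r}}(\mathbf{n})=e^{-\sigma|\tau(\mathbf{n})|}$ for all $\mathbf{n}\in\mathbb{Z}^\infty$ (for $\sigma=\infty$ this means $1$ if $\mathbf{n}=\mathbf{0}$ and $0$ otherwise, so $P_{\mathbf{0}}$ is Haar measure). $P_{\mathbf{r},\boldsymbol{\lambda}}$ is its translate $P_{\mathbf{r},\boldsymbol{\lambda}}(E)=P_{\mathbf{r}}(E\boldsymbol{\lambda}^{-1})$ for Borel $E\subset\mathbb{T}^\omega$. *)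

theory Defs
  imports
    "HOL-Analysis.Analysis"
    "HOL-Computational_Algebra.Primes"
    "HOL-Library.Poly_Mapping"
begin

(* Coordinates are indexed from 0, so nth_prime 0 = 2, nth_prime 1 = 3, ... *)
definition nth_prime :: "nat \<Rightarrow> nat" where
  "nth_prime k = enumerate {q. prime q} k"

definition seq_mult :: "(nat \<Rightarrow> complex) \<Rightarrow> (nat \<Rightarrow> complex) \<Rightarrow> nat \<Rightarrow> complex"
    (infixl "\<odot>" 70) where
  "x \<odot> y = (\<lambda>k. x k * y k)"

(* The infinite torus, as a subset of nat => complex with its product topology. *)
definition torus :: "(nat \<Rightarrow> complex) set" where
  "torus = {x. \<forall>k. cmod (x k) = 1}"

(* Only the sigma-algebra of this measure is used. *)
definition torus_borel :: "(nat \<Rightarrow> complex) measure" where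
  "torus_borel = restrict_space borel torus"

definition tau :: "(nat \<Rightarrow>\<^sub>0 int) \<Rightarrow> real" where
  "tau n = (\<Sum>k\<in>Poly_Mapping.keys n. of_int (Poly_Mapping.lookup n k) * ln (real (nth_prime k)))"

definition character :: "(nat \<Rightarrow>\<^sub>0 int) \<Rightarrow> (nat \<Rightarrow> complex) \<Rightarrow> complex" where
  "character n x = (\<Prod>k\<in>Poly_Mapping.keys n. x k powi Poly_Mapping.lookup n k)"

definition is_normalized_haar :: "(nat \<Rightarrow> complex) measure \<Rightarrow> bool" where
  "is_normalized_haar M \<longleftrightarrow>
     sets M = sets torus_borel \<and> emeasure M torus = 1 \<and>
     (\<forall>l\<in>torus. \<forall>E\<in>sets M. emeasure M ((\<lambda>x. l \<odot> x) ` E) = emeasure M E)"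

definition haar :: "(nat \<Rightarrow> complex) measure" where
  "haar = (THE M. is_normalized_haar M)"

definition fourier_fun :: "((nat \<Rightarrow> complex) \<Rightarrow> complex) \<Rightarrow> (nat \<Rightarrow>\<^sub>0 int) \<Rightarrow> complex" where
  "fourier_fun f n = (LINT x|haar. f x * cnj (character n x))"

definition fourier_measure :: "(nat \<Rightarrow> complex) measure \<Rightarrow> (nat \<Rightarrow>\<^sub>0 int) \<Rightarrow> complex" where
  "fourier_measure M n = (LINT x|M. cnj (character n x))"

(* Functions on the torus are represented by their extensional representatives on
   nat => complex, so that equality in A_tau is equality on the torus. *)
definition A_tau :: "((nat \<Rightarrow> complex) \<Rightarrow> complex) set" where
  "A_tau = {f \<in> extensional torus.
     continuous_on torus f \<and> (\<forall>n. tau n < 0 \<longrightarrow> fourier_fun f n = 0)}"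

(* Complex homomorphisms of an algebra A of functions on X with pointwise operations;
   functionals are extensional on A, so that equality is equality on A. *)
definition complex_homs ::
    "'a set \<Rightarrow> ('a \<Rightarrow> complex) set \<Rightarrow> (('a \<Rightarrow> complex) \<Rightarrow> complex) set" where
  "complex_homs X A = {\<phi> \<in> extensional A.
     (\<exists>f\<in>A. \<phi> f \<noteq> 0) \<and>
     (\<forall>f\<in>A. \<forall>g\<in>A. \<phi> (\<lambda>x\<in>X. f x + g x) = \<phi> f + \<phi> g) \<and>
     (\<forall>c. \<forall>f\<in>A. \<phi> (\<lambda>x\<in>X. c * f x) = c * \<phi> f) \<and>
     (\<forall>f\<in>A. \<forall>g\<in>A. \<phi> (\<lambda>x\<in>X. f x * g x) = \<phi> f * \<phi> g)}"

(* The type ennreal is [0,\<infinity>]. *)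
definition p_neg_pow :: "ennreal \<Rightarrow> nat \<Rightarrow> complex" where
  "p_neg_pow \<sigma> k =
     (if \<sigma> = \<infinity> then 0 else complex_of_real (real (nth_prime k) powr - enn2real \<sigma>))"

definition frakD :: "(nat \<Rightarrow> complex) set" where
  "frakD = {p_neg_pow \<sigma> \<odot> l | \<sigma> l. l \<in> torus}"

definition poisson_coeff :: "ennreal \<Rightarrow> (nat \<Rightarrow>\<^sub>0 int) \<Rightarrow> real" where
  "poisson_coeff \<sigma> n =
     (if \<sigma> = \<infinity> then (if n = 0 then 1 else 0) else exp (- enn2real \<sigma> * \<bar>tau n\<bar>))"

(* The Poisson measure of r = p_neg_pow \<sigma>, indexed by \<sigma>
   (which r determines). *)
definition poisson :: "ennreal \<Rightarrow> (nat \<Rightarrow> complex) measure" where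
  "poisson \<sigma> = (THE M. sets M = sets torus_borel \<and> finite_measure M \<and>
     (\<forall>n. fourier_measure M n = complex_of_real (poisson_coeff \<sigma> n)))"

(* The push-forward under x \<mapsto> x l gives E the mass of {x. x l \<in> E} = E l^{-1}. *)
definition poisson_translate :: "ennreal \<Rightarrow> (nat \<Rightarrow> complex) \<Rightarrow> (nat \<Rightarrow> complex) measure" where
  "poisson_translate \<sigma> l = distr (poisson \<sigma>) torus_borel (\<lambda>x. x \<odot> l)"

definition poisson_functional ::
    "ennreal \<Rightarrow> (nat \<Rightarrow> complex) \<Rightarrow> ((nat \<Rightarrow> complex) \<Rightarrow> complex) \<Rightarrow> complex" where
  "poisson_functional \<sigma> l = (\<lambda>f\<in>A_tau. LINT x|poisson_translate \<sigma> l. f x)"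

end

theory Submission
  imports Defs
    "HOL-Probability.Infinite_Product_Measure"
    "HOL-Complex_Analysis.Cauchy_Integral_Formula"
begin

text \<open>The idea is that everything is decided on characters. For a frequency \<open>n\<close> with \<open>tau n \<ge> 0\<close>, the integral of
\<open>character n\<close> against the Poisson measure translated by \<open>l\<close> is \<open>exp (- \<sigma> tau n) * character n l\<close> (for \<open>\<sigma> = \<infinity>\<close>: \<open>1\<close> if
\<open>n = 0\<close> and \<open>0\<close> otherwise), which is the value of the character at the point \<open>z = p\<^sup>-\<^sup>\<sigma> \<odot> l\<close> (\<open>poisson_functional_character\<close>). On nonnegative
frequencies these values are multiplicative in \<open>n\<close>, so the Poisson functional is multiplicative on trigonometric
polynomials with nonnegative frequencies. Such polynomials are uniformly dense in the algebra (\<open>A_tau_approx\<close>):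
convolve \<open>f\<close> with a trigonometric polynomial close to a bump of integral one near the identity; the
frequencies of the convolution are frequencies of \<open>f\<close>. Hence the functional is multiplicative on the whole algebra.

Conversely, a complex homomorphism is automatically a contraction (\<open>hom_bounded\<close>), so by density it is
determined by its values \<open>u n\<close> at the characters (\<open>homs_eqI\<close>). These satisfy \<open>u (n + m) = u n * u m\<close> and
\<open>\<bar>u n\<bar> \<le> 1\<close>. The frequencies embed into the real line through \<open>tau\<close>, by unique prime factorization, and
the Archimedean property leaves only two possibilities: \<open>u\<close> vanishes except at \<open>0\<close>, or \<open>u\<close> is evaluation
at a point \<open>z\<close> with \<open>\<bar>z\<^sub>k\<bar> = p\<^sub>k\<^sup>-\<^sup>\<sigma>\<close> for all \<open>k\<close> and a common \<open>\<sigma> \<ge> 0\<close> (\<open>representation\<close>). Either way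
\<open>u\<close> is evaluation at a point of \<open>frakD\<close>. The map is injective because \<open>z\<^sub>k\<close> is the value at the character of
the \<open>k\<close>-th unit vector.

Haar measure and the Poisson measures are given by descriptions, so existence and uniqueness have to be
established. Uniqueness follows from the Stone-Weierstrass theorem: a finite measure on the torus is determined by its Fourier
coefficients (\<open>torus_measure_eq_if_fourier_measure_eq\<close>). Haar measure exists as the law of independent
uniform phases. For finite \<open>\<sigma>\<close> the Poisson measure is the image of a Cauchy distribution under
\<open>s \<mapsto> (p\<^sub>k\<^sup>i\<^sup>s)\<^sub>k\<close>; its coefficients come from the mean value property of
\<open>exp (- a (1 + w) / (1 - w))\<close> in the unit disc (\<open>integral_cis_cot_nonneg\<close>).\<close>

section \<open>Frequencies and characters\<close>

lemma prime_nth_prime: "prime (nth_prime k)"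
  using enumerate_in_set[OF primes_infinite, of k] by (simp add: nth_prime_def)

lemma nth_prime_inject [simp]: "nth_prime j = nth_prime k \<longleftrightarrow> j = k"
proof -
  have "inj (enumerate {q::nat. prime q})"
    using strict_mono_enumerate[OF primes_infinite] strict_mono_imp_inj_on by blast
  then show ?thesis by (auto simp: nth_prime_def inj_def)
qed

lemma ln_nth_prime_pos: "ln (real (nth_prime k)) > 0"
  using prime_gt_1_nat[OF prime_nth_prime[of k]] by (intro ln_gt_zero) auto

lemma tau_superset:
  assumes "finite K" "Poly_Mapping.keys n \<subseteq> K"
  shows "tau n = (\<Sum>k\<in>K. of_int (Poly_Mapping.lookup n k) * ln (real (nth_prime k)))"
  unfolding tau_def using assms by (intro sum.mono_neutral_left) (auto simp: in_keys_iff)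

lemma tau_0 [simp]: "tau 0 = 0"
  by (simp add: tau_def)

lemma tau_add: "tau (n + m) = tau n + tau m"
proof -
  let ?K = "Poly_Mapping.keys n \<union> Poly_Mapping.keys m"
  have "tau (n + m) = (\<Sum>k\<in>?K. of_int (Poly_Mapping.lookup (n + m) k) * ln (real (nth_prime k)))"
    using Poly_Mapping.keys_add[of n m] by (intro tau_superset) auto
  then show ?thesis
    by (simp add: tau_superset[of ?K n] tau_superset[of ?K m] lookup_add algebra_simps sum.distrib)
qed

lemma tau_uminus: "tau (- n) = - tau n"
  using tau_add[of n "- n"] by simp

lemma tau_diff: "tau (n - m) = tau n - tau m"
  using tau_add[of n "- m"] by (simp add: tau_uminus)

lemma tau_single: "tau (Poly_Mapping.single k a) = of_int a * ln (real (nth_prime k))"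
  by (simp add: tau_def)

text \<open>This is the uniqueness of prime factorization: a relation \<open>\<tau>(n) = 0\<close> says that two
  products of prime powers with disjoint supports coincide.\<close>
lemma tau_eq_0_iff: "tau n = 0 \<longleftrightarrow> n = 0"
proof
  assume 0: "tau n = 0"
  let ?l = "Poly_Mapping.lookup n"
  let ?K = "Poly_Mapping.keys n"
  let ?p = "\<lambda>k. real (nth_prime k)"
  have pos: "?p k > 0" for k using prime_gt_0_nat[OF prime_nth_prime[of k]] by simp
  define A where "A = (\<Prod>k\<in>?K. nth_prime k ^ nat (?l k))"
  define B where "B = (\<Prod>k\<in>?K. nth_prime k ^ nat (- ?l k))"
  have diff: "(\<Sum>k\<in>?K. real (nat (?l k)) * ln (?p k)) - (\<Sum>k\<in>?K. real (nat (- ?l k)) * ln (?p k)) = tau n"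
    unfolding tau_def sum_subtractf[symmetric]
    by (intro sum.cong refl) (auto simp: left_diff_distrib[symmetric] of_nat_nat max_def
        simp flip: of_nat_diff split: split_nat)
  have "ln (real A) = (\<Sum>k\<in>?K. real (nat (?l k)) * ln (?p k))"
    unfolding A_def using pos by (simp add: ln_prod ln_realpow)
  moreover have "ln (real B) = (\<Sum>k\<in>?K. real (nat (- ?l k)) * ln (?p k))"
    unfolding B_def using pos by (simp add: ln_prod ln_realpow)
  ultimately have "ln (real A) = ln (real B)" using diff 0 by (simp only: right_minus_eq)
  moreover have "A > 0" "B > 0"
    unfolding A_def B_def using pos by (auto intro!: prod_pos)
  ultimately have "A = B" by simp
  have dvd: "nth_prime k dvd (\<Prod>j\<in>?K. nth_prime j ^ nat (s j)) \<longleftrightarrow> k \<in> ?K \<and> s k > 0" for k s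
  proof
    assume "nth_prime k dvd (\<Prod>j\<in>?K. nth_prime j ^ nat (s j))"
    then obtain j where j: "j \<in> ?K" "nth_prime k dvd nth_prime j ^ nat (s j)"
      using prime_dvd_prod_iff[of ?K "nth_prime k"] prime_nth_prime by auto
    then have "nth_prime k dvd nth_prime j" using prime_dvd_power[OF prime_nth_prime] j(2) by simp
    then have "nth_prime k = nth_prime j" by (intro primes_dvd_imp_eq prime_nth_prime)
    then have "k = j" by simp
    moreover have "s j > 0"
    proof (rule ccontr)
      assume "\<not> s j > 0"
      then show False using j(2) prime_gt_1_nat[OF prime_nth_prime[of k]] by simp
    qed
    ultimately show "k \<in> ?K \<and> s k > 0" using j by simp
  next
    assume k: "k \<in> ?K \<and> s k > 0"
    then have "nth_prime k dvd nth_prime k ^ nat (s k)" by (intro dvd_power) auto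
    then show "nth_prime k dvd (\<Prod>j\<in>?K. nth_prime j ^ nat (s j))"
      using k dvd_prodI[of ?K k "\<lambda>j. nth_prime j ^ nat (s j)"] by (auto intro: dvd_trans)
  qed
  have "?K = {}"
  proof (rule ccontr)
    assume "?K \<noteq> {}"
    then obtain k where k: "k \<in> ?K" by blast
    then have "?l k \<noteq> 0" by (simp add: in_keys_iff)
    moreover have "?l k > 0 \<longleftrightarrow> - ?l k > 0"
      using dvd[of k ?l] dvd[of k "\<lambda>j. - ?l j"] k \<open>A = B\<close> unfolding A_def B_def by metis
    ultimately show False by linarith
  qed
  then show "n = 0" by simp
qed simp

lemma character_superset:
  assumes "finite K" "Poly_Mapping.keys n \<subseteq> K"
  shows "character n x = (\<Prod>k\<in>K. x k powi Poly_Mapping.lookup n k)"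
  unfolding character_def using assms by (intro prod.mono_neutral_left) (auto simp: in_keys_iff)

lemma character_0 [simp]: "character 0 x = 1"
  by (simp add: character_def)

lemma character_single [simp]: "character (Poly_Mapping.single k a) x = x k powi a"
  by (cases "a = 0") (auto simp: character_def)

lemma character_add:
  assumes "\<And>k. x k \<noteq> 0"
  shows "character (n + m) x = character n x * character m x"
proof -
  let ?K = "Poly_Mapping.keys n \<union> Poly_Mapping.keys m"
  have "character (n + m) x = (\<Prod>k\<in>?K. x k powi Poly_Mapping.lookup (n + m) k)"
    using Poly_Mapping.keys_add[of n m] by (intro character_superset) auto
  then show ?thesis
    using assms
    by (simp add: character_superset[of ?K n] character_superset[of ?K m] lookup_add
        power_int_add prod.distrib)
qed

lemma character_nonzero: "(\<And>k. x k \<noteq> 0) \<Longrightarrow> character n x \<noteq> 0"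
  by (simp add: character_def)

lemma character_uminus:
  assumes "\<And>k. x k \<noteq> 0"
  shows "character (- n) x = inverse (character n x)"
  using character_add[of x n "- n"] assms by (simp add: inverse_unique)

lemma character_diff:
  assumes "\<And>k. x k \<noteq> 0"
  shows "character (n - m) x = character n x / character m x"
  using character_add[of x n "- m"] character_uminus[of x m] assms by (simp add: field_simps)

lemma character_seq_mult: "character n (x \<odot> y) = character n x * character n y"
  by (simp add: character_def seq_mult_def power_int_mult_distrib prod.distrib)

text \<open>Since \<open>0 powi a = 0\<close> for every \<open>a \<noteq> 0\<close>, negative exponents included, a character evaluated at the
zero sequence gives the Fourier coefficients of Haar measure. The point \<open>\<sigma> = \<infinity>\<close> therefore
obeys the same formulas as the others.\<close>
lemma character_zero_seq: "character n (\<lambda>_. 0) = (if n = 0 then 1 else 0)"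
proof (cases "n = 0")
  case False
  have "character n (\<lambda>_. 0) = (\<Prod>k\<in>Poly_Mapping.keys n. 0)"
    unfolding character_def by (intro prod.cong) (auto simp: in_keys_iff power_int_0_left_if)
  then show ?thesis using False by (simp add: card_gt_0_iff)
qed simp

section \<open>The torus as a compact group\<close>

lemma torus_nonzero: "x \<in> torus \<Longrightarrow> x k \<noteq> 0"
  by (auto simp: torus_def dest!: spec[of _ k])

lemma seq_mult_torus: "x \<in> torus \<Longrightarrow> y \<in> torus \<Longrightarrow> x \<odot> y \<in> torus"
  by (simp add: torus_def seq_mult_def norm_mult)

text \<open>On the torus this is the group inverse.\<close>
definition seq_cnj :: "(nat \<Rightarrow> complex) \<Rightarrow> nat \<Rightarrow> complex" where
  "seq_cnj x = (\<lambda>k. cnj (x k))"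

lemma seq_cnj_torus: "x \<in> torus \<Longrightarrow> seq_cnj x \<in> torus"
  by (simp add: torus_def seq_cnj_def)

lemma seq_mult_commute: "x \<odot> y = y \<odot> x"
  by (simp add: seq_mult_def mult.commute)

lemma seq_mult_cnj_cancel:
  assumes "l \<in> torus"
  shows "seq_cnj l \<odot> (l \<odot> x) = x" "l \<odot> (seq_cnj l \<odot> x) = x"
proof -
  have "l k * cnj (l k) = 1" for k
    using assms by (simp add: torus_def flip: complex_norm_square)
  then have "cnj (l k) * (l k * x k) = x k" "l k * (cnj (l k) * x k) = x k" for k
    by (metis mult.assoc mult.commute mult_1)+
  then show "seq_cnj l \<odot> (l \<odot> x) = x" "l \<odot> (seq_cnj l \<odot> x) = x"
    unfolding seq_mult_def seq_cnj_def by (simp_all only:)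
qed

lemma cnj_power_int: "cnj (z powi a) = cnj z powi a"
  by (simp add: power_int_def)

lemma character_seq_cnj: "character n (seq_cnj x) = cnj (character n x)"
  by (simp add: character_def seq_cnj_def cnj_power_int)

lemma norm_character: "x \<in> torus \<Longrightarrow> cmod (character n x) = 1"
  by (simp add: character_def torus_def norm_power_int flip: prod_norm)

lemma character_uminus_torus: "x \<in> torus \<Longrightarrow> character (- n) x = cnj (character n x)"
  using norm_character[of x n] torus_nonzero[of x] 
  by (simp add: character_uminus complex_cnj_inverse divide_conv_cnj inverse_eq_divide)

lemma compact_torus: "compact torus"
proof -
  have "torus = (PiE UNIV (\<lambda>_. sphere 0 1))"
    by (auto simp: torus_def)
  then show ?thesis
    by (metis compactin_PiE compactin_euclidean_iff euclidean_product_topology compact_sphere)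
qed

lemma continuous_on_seq_mult [continuous_intros]:
  assumes "continuous_on A f" "continuous_on A g"
  shows "continuous_on A (\<lambda>x. f x \<odot> g x)"
  using assms unfolding seq_mult_def
  by (intro continuous_on_coordinatewise_then_product continuous_on_mult) (auto intro: continuous_on_product_then_coordinatewise)

lemma continuous_on_seq_cnj [continuous_intros]:
  assumes "continuous_on A f"
  shows "continuous_on A (\<lambda>x. seq_cnj (f x))"
  using assms unfolding seq_cnj_def
  by (intro continuous_on_coordinatewise_then_product continuous_on_cnj) (auto intro: continuous_on_product_then_coordinatewise)

lemma continuous_on_character: "continuous_on torus (character n)"
  unfolding character_def using torus_nonzero
  by (intro continuous_on_prod continuous_on_power_int)
     (auto intro: continuous_on_product_then_coordinatewise[OF continuous_on_id, simplified])

section \<open>Trigonometric polynomials\<close>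

text \<open>Finite linear combinations of characters with frequencies in \<open>S\<close>. Identities such as
\<open>character (n + m) x = character n x * character m x\<close> fail at sequences with zero coordinates, so the last
rule identifies functions that agree on the torus.\<close>
inductive trig_poly :: "(nat \<Rightarrow>\<^sub>0 int) set \<Rightarrow> ((nat \<Rightarrow> complex) \<Rightarrow> complex) \<Rightarrow> bool"
  for S where
  monomial: "n \<in> S \<Longrightarrow> trig_poly S (\<lambda>x. c * character n x)"
| add: "trig_poly S p \<Longrightarrow> trig_poly S q \<Longrightarrow> trig_poly S (\<lambda>x. p x + q x)"
| cong: "trig_poly S p \<Longrightarrow> (\<And>x. x \<in> torus \<Longrightarrow> p x = q x) \<Longrightarrow> trig_poly S q"

lemma trig_poly_continuous: "trig_poly S p \<Longrightarrow> continuous_on torus p"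
proof (induction rule: trig_poly.induct)
  case (cong p q)
  then show ?case using continuous_on_cong by metis
qed (auto intro!: continuous_intros continuous_on_character)

lemma trig_poly_mult:
  assumes "\<And>n m. n \<in> S \<Longrightarrow> m \<in> S \<Longrightarrow> n + m \<in> S"
  assumes "trig_poly S p" "trig_poly S q"
  shows "trig_poly S (\<lambda>x. p x * q x)"
  using assms(2,3)
proof (induction arbitrary: q rule: trig_poly.induct)
  case (monomial n c)
  from monomial(2) show ?case
  proof (induction rule: trig_poly.induct)
    case (monomial m d)
    have "trig_poly S (\<lambda>x. (c * d) * character (n + m) x)"
      using assms(1) \<open>n \<in> S\<close> monomial by (intro trig_poly.monomial) auto
    then show ?case
      by (rule trig_poly.cong) (simp add: character_add torus_nonzero)
  next
    case (add p q)
    then show ?case using trig_poly.add[OF add.IH] by (simp add: algebra_simps)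
  next
    case (cong p q)
    show ?case by (rule trig_poly.cong[OF cong.IH]) (use cong.hyps in auto)
  qed
next
  case (add p1 p2)
  then show ?case using trig_poly.add[OF add.IH(1)[OF add.prems] add.IH(2)[OF add.prems]]
    by (simp add: algebra_simps)
next
  case (cong p1 p2)
  show ?case by (rule trig_poly.cong[OF cong.IH[OF cong.prems]]) (use cong.hyps in auto)
qed

lemma trig_poly_const: "0 \<in> S \<Longrightarrow> trig_poly S (\<lambda>_. c)"
  using trig_poly.monomial[of 0 S c] by simp

lemma trig_poly_cnj: "trig_poly UNIV p \<Longrightarrow> trig_poly UNIV (\<lambda>x. cnj (p x))"
proof (induction rule: trig_poly.induct)
  case (monomial n c)
  have "trig_poly UNIV (\<lambda>x. cnj c * character (- n) x)"
    by (rule trig_poly.monomial) auto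
  then show ?case by (rule trig_poly.cong) (simp add: character_uminus_torus)
next
  case (add p q)
  then show ?case using trig_poly.add[OF add.IH] by simp
next
  case (cong p q)
  show ?case by (rule trig_poly.cong[OF cong.IH]) (use cong.hyps in auto)
qed

text \<open>Stone-Weierstrass applies to the real-valued functions that agree on the torus with a
  trigonometric polynomial; the real and imaginary parts of the coordinates separate points.\<close>
lemma trig_poly_dense_real:
  fixes f :: "(nat \<Rightarrow> complex) \<Rightarrow> real"
  assumes "continuous_on torus f" "e > 0"
  obtains p where "trig_poly UNIV p" "\<And>x. x \<in> torus \<Longrightarrow> cmod (of_real (f x) - p x) < e"
proof -
  define P where "P = (\<lambda>g. trig_poly UNIV (\<lambda>x. complex_of_real (g x)))"
  have cont: "continuous_on torus g" if "P g" for g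
  proof -
    have "continuous_on torus (\<lambda>x. Re (complex_of_real (g x)))"
      by (intro continuous_on_Re trig_poly_continuous[of UNIV]) (use that in \<open>simp add: P_def\<close>)
    then show ?thesis by simp
  qed
  have sep: "\<exists>g. P g \<and> g x \<noteq> g y" if "x \<noteq> y" for x y
  proof -
    obtain k where k: "x k \<noteq> y k" using \<open>x \<noteq> y\<close> by (auto simp: fun_eq_iff)
    have c: "trig_poly UNIV (\<lambda>x. c * x k)" for c
      using trig_poly.monomial[of "Poly_Mapping.single k 1" UNIV c] by simp
    have "trig_poly UNIV (\<lambda>x. c * x k + cnj (c * x k))" for c
      by (intro trig_poly.add c trig_poly_cnj)
    then have "P (\<lambda>x. 2 * Re (c * x k))" for c
      unfolding P_def complex_add_cnj .
    from this[of 1] this[of \<i>] have "P (\<lambda>x. 2 * Re (x k))" "P (\<lambda>x. - 2 * Im (x k))"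
      by simp_all
    moreover have "2 * Re (x k) \<noteq> 2 * Re (y k) \<or> - 2 * Im (x k) \<noteq> - 2 * Im (y k)"
      using k by (simp add: complex_eq_iff)
    ultimately show ?thesis by blast
  qed
  have "\<exists>g. P g \<and> (\<forall>x\<in>torus. \<bar>f x - g x\<bar> < e)"
  proof (rule Stone_Weierstrass_HOL[OF compact_torus _ cont _ _ _ assms])
    show "P (\<lambda>x. c)" for c unfolding P_def by (rule trig_poly_const) simp
    show "P (\<lambda>x. f x + g x)" if "P f \<and> P g" for f g
      using that trig_poly.add unfolding P_def by fastforce
    show "P (\<lambda>x. f x * g x)" if "P f \<and> P g" for f g
      using that trig_poly_mult[of UNIV] unfolding P_def by simp
    show "\<exists>f. P f \<and> f x \<noteq> f y" if "x \<in> torus \<and> y \<in> torus \<and> x \<noteq> y" for x y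
      using sep that by blast
  qed
  then obtain g where "P g" "\<And>x. x \<in> torus \<Longrightarrow> \<bar>f x - g x\<bar> < e" by auto
  then show ?thesis
    by (intro that[of "\<lambda>x. of_real (g x)"]) (auto simp: P_def simp flip: of_real_diff)
qed

lemma trig_poly_dense:
  assumes "continuous_on torus f" "e > 0"
  obtains p where "trig_poly UNIV p" "\<And>x. x \<in> torus \<Longrightarrow> cmod (f x - p x) < e"
proof -
  obtain p where p: "trig_poly UNIV p" "\<And>x. x \<in> torus \<Longrightarrow> cmod (of_real (Re (f x)) - p x) < e / 2"
    using assms by (auto intro: trig_poly_dense_real[of "\<lambda>x. Re (f x)" "e / 2"] continuous_on_Re)
  obtain q where q: "trig_poly UNIV q" "\<And>x. x \<in> torus \<Longrightarrow> cmod (of_real (Im (f x)) - q x) < e / 2"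
    using assms by (auto intro: trig_poly_dense_real[of "\<lambda>x. Im (f x)" "e / 2"] continuous_on_Im)
  show ?thesis
  proof
    show "trig_poly UNIV (\<lambda>x. p x + \<i> * q x)"
      using p q by (intro trig_poly.add trig_poly_mult trig_poly_const) auto
    fix x assume x: "x \<in> torus"
    have "f x - (p x + \<i> * q x) = (of_real (Re (f x)) - p x) + \<i> * (of_real (Im (f x)) - q x)"
      by (subst complex_eq) (simp add: algebra_simps)
    also have "cmod \<dots> \<le> cmod (of_real (Re (f x)) - p x) + cmod (of_real (Im (f x)) - q x)"
      by (rule norm_triangle_le) (simp add: norm_mult)
    also have "\<dots> < e" using p(2)[OF x] q(2)[OF x] by simp
    finally show "cmod (f x - (p x + \<i> * q x)) < e" .
  qed
qed

section \<open>Measures on the torus are determined by their Fourier coefficients\<close>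

lemma space_torus_measure: "sets M = sets torus_borel \<Longrightarrow> space M = torus"
  using sets_eq_imp_space_eq[of M torus_borel] by (simp add: torus_borel_def space_restrict_space)

lemma torus_borel_sets_iff: "A \<in> sets torus_borel \<longleftrightarrow> A \<subseteq> torus \<and> A \<in> sets borel"
  using borel_closed[OF compact_imp_closed[OF compact_torus]]
  by (auto simp: torus_borel_def sets_restrict_space_iff)

lemma continuous_torus_measurable:
  assumes "sets M = sets torus_borel" "continuous_on torus f"
  shows "f \<in> borel_measurable M"
  unfolding measurable_cong_sets[OF assms(1) refl] torus_borel_def
  by (rule borel_measurable_continuous_on_restrict[OF assms(2)])

lemma measurable_into_torus:
  assumes "continuous_on torus f" "f ` torus \<subseteq> torus" "sets M = sets torus_borel"
  shows "f \<in> measurable M torus_borel"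
  using assms space_torus_measure[OF assms(3)] unfolding torus_borel_def
  by (intro measurable_restrict_space2 continuous_torus_measurable) (auto simp: torus_borel_def)

lemma continuous_torus_bounded:
  fixes f :: "(nat \<Rightarrow> complex) \<Rightarrow> 'b :: real_normed_vector"
  assumes "continuous_on torus f"
  obtains B where "B > 0" "\<And>x. x \<in> torus \<Longrightarrow> norm (f x) \<le> B"
  using compact_imp_bounded[OF compact_continuous_image[OF assms compact_torus]]
  by (auto simp: bounded_pos)

lemma continuous_torus_integrable:
  fixes f :: "(nat \<Rightarrow> complex) \<Rightarrow> 'b :: {banach, second_countable_topology}"
  assumes "finite_measure M" "sets M = sets torus_borel" "continuous_on torus f"
  shows "integrable M f"
proof -
  interpret finite_measure M by fact
  obtain B where "\<And>x. x \<in> torus \<Longrightarrow> norm (f x) \<le> B"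
    using continuous_torus_bounded[OF assms(3)] by metis
  then show ?thesis
    using space_torus_measure[OF assms(2)]
    by (intro integrable_const_bound[of _ B] continuous_torus_measurable assms AE_I2) auto
qed

lemma integral_torus_close:
  fixes f g :: "(nat \<Rightarrow> complex) \<Rightarrow> complex"
  assumes M: "finite_measure M" "sets M = sets torus_borel"
    and f: "continuous_on torus f" and g: "continuous_on torus g"
    and le: "\<And>x. x \<in> torus \<Longrightarrow> cmod (f x - g x) \<le> e"
  shows "cmod ((LINT x|M. f x) - (LINT x|M. g x)) \<le> e * measure M torus"
proof -
  interpret finite_measure M by fact
  note int = continuous_torus_integrable[OF M]
  have "cmod ((LINT x|M. f x) - (LINT x|M. g x)) = cmod (LINT x|M. f x - g x)"
    using int[OF f] int[OF g] by simp
  also have "\<dots> \<le> (LINT x|M. cmod (f x - g x))" by (rule integral_norm_bound)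
  also have "\<dots> \<le> (LINT x|M. e)"
    using le space_torus_measure[OF M(2)] by (intro integral_mono int continuous_intros f g) auto
  finally show ?thesis using space_torus_measure[OF M(2)] by (simp add: mult.commute)
qed

lemma integral_character_eq_fourier_measure:
  assumes "sets M = sets torus_borel"
  shows "(LINT x|M. character n x) = fourier_measure M (- n)"
  unfolding fourier_measure_def
  by (intro Bochner_Integration.integral_cong refl)
     (simp add: space_torus_measure[OF assms] character_uminus_torus)

text \<open>The functions \<open>max 0 (1 - n dist(x, C))\<close> decrease to the indicator function of a closed
  set \<open>C\<close>, and the closed sets are a generator of the Borel sets that is stable under
  intersections.\<close>
lemma torus_measure_eqI:
  assumes M: "finite_measure M" "sets M = sets torus_borel"
    and N: "finite_measure N" "sets N = sets torus_borel"
    and eq: "\<And>f :: (nat \<Rightarrow> complex) \<Rightarrow> real. continuous_on UNIV f \<Longrightarrow> (LINT x|M. f x) = (LINT x|N. f x)"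
  shows "M = N"
proof -
  have id: "(\<lambda>x. x) \<in> measurable M borel" "(\<lambda>x. x) \<in> measurable N borel"
    using continuous_torus_measurable M N continuous_on_id by blast+
  have emb: "emeasure (distr K borel (\<lambda>x. x)) A = emeasure K (A \<inter> torus)"
    if "A \<in> sets borel" "K = M \<or> K = N" for A K
    using that id M N space_torus_measure[of K]
    by (subst emeasure_distr) auto
  have conv: "(\<lambda>n. LINT x|K. max 0 (1 - real n * infdist x C)) \<longlonglongrightarrow> measure K (C \<inter> torus)"
    if C: "closed C" "C \<noteq> {}" and K: "finite_measure K" "sets K = sets torus_borel" for K C
  proof -
    interpret finite_measure K by fact
    have "(\<lambda>n. LINT x|K. max 0 (1 - real n * infdist x C)) \<longlonglongrightarrow> (LINT x|K. indicator C x)"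
    proof (rule integral_dominated_convergence[where w="\<lambda>_. 1"])
      show "indicator C \<in> borel_measurable K" 
        using C K id unfolding torus_borel_def by (auto intro!: borel_measurable_indicator' measurable_restrict_space1 borel_closed simp: measurable_cong_sets[OF K(2)[unfolded torus_borel_def] refl])
      show "(\<lambda>x. max 0 (1 - real n * infdist x C)) \<in> borel_measurable K" for n
        by (intro continuous_torus_measurable K continuous_intros)
      show "AE x in K. (\<lambda>n. max 0 (1 - real n * infdist x C)) \<longlonglongrightarrow> indicator C x"
      proof (rule AE_I2)
        fix x
        show "(\<lambda>n. max 0 (1 - real n * infdist x C)) \<longlonglongrightarrow> indicator C x"
        proof (cases "x \<in> C")
          case False
          then have pos: "infdist x C > 0"
            using C infdist_nonneg[of x C] in_closed_iff_infdist_zero[of C x] by fastforce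
          obtain n0 where n0: "real n0 > 1 / infdist x C" using reals_Archimedean2 by blast
          have "eventually (\<lambda>n. max 0 (1 - real n * infdist x C) = 0) sequentially"
            using eventually_ge_at_top[of n0]
          proof eventually_elim
            case (elim n)
            then have "1 / infdist x C \<le> real n" using n0 by linarith
            then show ?case using pos by (simp add: field_simps max_def)
          qed
          then show ?thesis using False by (simp add: tendsto_eventually)
        qed simp
      qed
      show "AE x in K. norm (max 0 (1 - real n * infdist x C)) \<le> 1" for n
        by (rule AE_I2) (simp add: infdist_nonneg)
    qed auto
    also have "(LINT x|K. indicator C x) = measure K (C \<inter> torus)"
      using C by (simp add: space_torus_measure[OF K(2)])
    finally show ?thesis .
  qed
  have "distr M borel (\<lambda>x. x) = distr N borel (\<lambda>x. x)"
  proof (rule measure_eqI_generator_eq[where E="Collect closed" and \<Omega>=UNIV and A="\<lambda>_. UNIV"])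
    show "Int_stable (Collect closed :: (nat \<Rightarrow> complex) set set)" by (auto simp: Int_stable_def)
    show "emeasure (distr M borel (\<lambda>x. x)) C = emeasure (distr N borel (\<lambda>x. x)) C" if "C \<in> Collect closed" for C
    proof (cases "C = {}")
      case False
      have "(LINT x|M. max 0 (1 - real n * infdist x C)) = (LINT x|N. max 0 (1 - real n * infdist x C))" for n
        by (intro eq continuous_intros)
      then have "measure M (C \<inter> torus) = measure N (C \<inter> torus)"
        using conv[OF _ False M] conv[OF _ False N] that by (simp add: LIMSEQ_unique)
      then show ?thesis
        using that M(1) N(1) by (simp add: emb borel_closed finite_measure.emeasure_eq_measure)
    qed simp
    show "emeasure (distr M borel (\<lambda>x. x)) UNIV \<noteq> \<infinity>"
      using M by (simp add: emb finite_measure.emeasure_finite)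
    have "sets borel = sigma_sets UNIV (Collect closed :: (nat \<Rightarrow> complex) set set)"
      by (subst borel_eq_closed) simp
    then show "sets (distr M borel (\<lambda>x. x)) = sigma_sets UNIV (Collect closed)"
      "sets (distr N borel (\<lambda>x. x)) = sigma_sets UNIV (Collect closed)" by simp_all
  qed auto
  then have "emeasure M (A \<inter> torus) = emeasure N (A \<inter> torus)" if "A \<in> sets borel" for A
    using emb[OF that, of M] emb[OF that, of N] by simp
  then have "emeasure M A = emeasure N A" if "A \<in> sets torus_borel" for A
    using that Int_absorb2[of A torus] by (metis torus_borel_sets_iff)
  then show ?thesis
    using M N by (intro measure_eqI) auto
qed

lemma nonpos_if_le_small_multiples:
  fixes x C :: real
  assumes "\<And>e. 0 < e \<Longrightarrow> x \<le> e * C"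
  shows "x \<le> 0"
proof (rule ccontr)
  assume "\<not> x \<le> 0"
  define D where "D = \<bar>C\<bar> + 1"
  have D: "D > 0" "C \<le> D" unfolding D_def by linarith+
  have "x \<le> x / (2 * D) * C" using D \<open>\<not> x \<le> 0\<close> by (intro assms) simp
  also have "\<dots> \<le> x / (2 * D) * D"
    using D \<open>\<not> x \<le> 0\<close> by (intro mult_left_mono) auto
  also have "\<dots> = x / 2" using D by simp
  finally show False using \<open>\<not> x \<le> 0\<close> by simp
qed

text \<open>The Fourier coefficients determine the integrals of trigonometric polynomials, and these are
uniformly dense.\<close>
lemma integral_eq_if_fourier_measure_eq:
  assumes M: "finite_measure M" "sets M = sets torus_borel"
    and N: "finite_measure N" "sets N = sets torus_borel"
    and eq: "\<And>n. fourier_measure M n = fourier_measure N n"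
    and f: "continuous_on torus f"
  shows "(LINT x|M. f x) = (LINT x|N. f x :: complex)"
proof -
  have poly: "(LINT x|M. p x) = (LINT x|N. p x)" if "trig_poly UNIV p" for p
    using that
  proof (induction rule: trig_poly.induct)
    case (monomial n c)
    then show ?case
      using eq by (simp add: integral_character_eq_fourier_measure M N)
  next
    case (add p q)
    have "continuous_on torus p" "continuous_on torus q"
      using add.hyps trig_poly_continuous by auto
    then show ?case
      using add.IH by (simp add: continuous_torus_integrable[OF M] continuous_torus_integrable[OF N])
  next
    case (cong p q)
    have "(LINT x|K. p x) = (LINT x|K. q x)" if "sets K = sets torus_borel" for K
      using cong.hyps space_torus_measure[OF that] by (intro Bochner_Integration.integral_cong) auto
    then show ?case using cong.IH M N by metis
  qed
  let ?d = "cmod ((LINT x|M. f x) - (LINT x|N. f x))"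
  let ?C = "measure M torus + measure N torus"
  have "?d \<le> e * ?C" if "e > 0" for e
  proof -
    obtain p where p: "trig_poly UNIV p" "\<And>x. x \<in> torus \<Longrightarrow> cmod (f x - p x) < e"
      using trig_poly_dense[OF f \<open>e > 0\<close>] by blast
    have cp: "continuous_on torus p" using p(1) by (rule trig_poly_continuous)
    have "cmod ((LINT x|M. f x) - (LINT x|M. p x)) \<le> e * measure M torus"
      using p(2) by (intro integral_torus_close M f cp) (auto intro: less_imp_le)
    moreover have "cmod ((LINT x|N. f x) - (LINT x|N. p x)) \<le> e * measure N torus"
      using p(2) by (intro integral_torus_close N f cp) (auto intro: less_imp_le)
    ultimately show ?thesis
      using norm_triangle_ineq4[of "(LINT x|M. f x) - (LINT x|M. p x)" "(LINT x|N. f x) - (LINT x|N. p x)"]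
        poly[OF p(1)] by (simp add: algebra_simps)
  qed
  then have "?d \<le> 0" by (rule nonpos_if_le_small_multiples)
  then show ?thesis by simp
qed

lemma torus_measure_eq_if_fourier_measure_eq:
  assumes M: "finite_measure M" "sets M = sets torus_borel"
    and N: "finite_measure N" "sets N = sets torus_borel"
    and eq: "\<And>n. fourier_measure M n = fourier_measure N n"
  shows "M = N"
proof (rule torus_measure_eqI[OF M N])
  fix f :: "(nat \<Rightarrow> complex) \<Rightarrow> real" assume "continuous_on UNIV f"
  then have "continuous_on torus (\<lambda>x. complex_of_real (f x))"
    by (intro continuous_intros) (auto intro: continuous_on_subset)
  then have "(LINT x|M. complex_of_real (f x)) = (LINT x|N. complex_of_real (f x))"
    by (intro integral_eq_if_fourier_measure_eq M N eq)
  then show "(LINT x|M. f x) = (LINT x|N. f x)" by (simp only: integral_complex_of_real of_real_eq_iff)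
qed

section \<open>Haar measure\<close>

definition unit_interval_measure :: "real measure" where
  "unit_interval_measure = restrict_space lborel {0..1}"

lemma prob_space_unit_interval_measure: "prob_space unit_interval_measure"
  by (rule prob_spaceI)
     (simp add: unit_interval_measure_def emeasure_restrict_space space_restrict_space)

lemma measurable_unit_interval [measurable]: "(\<lambda>t. t) \<in> borel_measurable unit_interval_measure"
  by (simp add: unit_interval_measure_def measurable_restrict_space1)

lemma integral_unit_interval_cis:
  assumes "a \<noteq> 0"
  shows "(LINT t|unit_interval_measure. cis (2 * pi * real_of_int a * t)) = 0"
proof -
  let ?F = "\<lambda>t. cis (2 * pi * real_of_int a * t) / (\<i> * of_real (2 * pi * real_of_int a))"
  have "(LINT t|unit_interval_measure. cis (2 * pi * real_of_int a * t)) =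
    (LINT t|lborel. indicator {0..1} t *\<^sub>R cis (2 * pi * real_of_int a * t))"
    unfolding unit_interval_measure_def by (rule integral_restrict_space) simp
  also have "\<dots> = ?F 1 - ?F 0"
  proof (rule integral_FTC_atLeastAtMost)
    show "(?F has_vector_derivative cis (2 * pi * real_of_int a * t)) (at t within {0..1})" for t
      using assms
      by (auto simp: cis_conv_exp intro!: derivative_eq_intros has_vector_derivative_real_field[where f="\<lambda>t. exp (\<i> * (2 * of_real pi * of_int a * t)) / (\<i> * of_real (2 * pi * real_of_int a))", simplified])
    show "continuous_on {0..1} (\<lambda>t. cis (2 * pi * real_of_int a * t))"
      by (auto simp: cis_conv_exp intro!: continuous_intros)
  qed simp
  also have "\<dots> = 0"
    using cis_multiple_2pi[of "real_of_int a"] by (simp add: mult.commute)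
  finally show ?thesis .
qed

lemma integral_distr_torus:
  assumes "g \<in> measurable M torus_borel" "continuous_on torus f"
  shows "(LINT x|distr M torus_borel g. f x) = (LINT x|M. f (g x) :: complex)"
  using assms by (intro integral_distr continuous_torus_measurable refl)

text \<open>The law of a sequence of independent uniformly distributed phases. It turns out to be Haar measure.\<close>
definition random_phases :: "(nat \<Rightarrow> complex) measure" where
  "random_phases =
     distr (\<Pi>\<^sub>M k\<in>(UNIV :: nat set). unit_interval_measure) torus_borel (\<lambda>t k. cis (2 * pi * t k))"

text \<open>By independence a Fourier coefficient is a product over the coordinates, and a coordinate with
nonzero exponent contributes the factor \<open>0\<close>.\<close>
lemma random_phases:
  shows "sets random_phases = sets torus_borel" "prob_space random_phases"
    "n \<noteq> 0 \<Longrightarrow> fourier_measure random_phases n = 0"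
proof -
  let ?I = "\<lambda>k::nat. unit_interval_measure"
  let ?Q = "\<Pi>\<^sub>M k\<in>UNIV. ?I k"
  let ?g = "\<lambda>t k. cis (2 * pi * t k)"
  interpret U: prob_space unit_interval_measure by (rule prob_space_unit_interval_measure)
  interpret product_prob_space ?I UNIV by unfold_locales
  have coord: "(\<lambda>t. t k) \<in> borel_measurable ?Q" for k
    using measurable_compose[OF measurable_component_singleton[of k UNIV ?I] measurable_unit_interval] by simp
  have g: "?g \<in> measurable ?Q torus_borel"
    unfolding torus_borel_def
  proof (rule measurable_restrict_space2)
    show "?g \<in> borel_measurable ?Q"
      by (rule measurable_coordinatewise_then_product)
         (use coord in \<open>auto simp: cis_conv_exp intro!: borel_measurable_continuous_on[OF _ coord] continuous_intros\<close>)
  qed (auto simp: torus_def)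
  show "sets random_phases = sets torus_borel" by (simp add: random_phases_def)
  show "prob_space random_phases"
    unfolding random_phases_def by (rule P.prob_space_distr[OF g])
  assume "n \<noteq> 0"
  let ?K = "Poly_Mapping.keys n"
  let ?h = "\<lambda>k t. cis (2 * pi * real_of_int (- Poly_Mapping.lookup n k) * t)"
  have h: "continuous_on UNIV (?h k)" for k
    by (auto simp: cis_conv_exp intro!: continuous_intros)
  have hm: "?h k \<in> borel_measurable unit_interval_measure" for k
    by (rule borel_measurable_continuous_on[OF h]) simp
  have prod_hm: "(\<lambda>t. \<Prod>k\<in>?K. ?h k (t k)) \<in> borel_measurable (\<Pi>\<^sub>M k\<in>?K. ?I k)"
  proof (rule borel_measurable_prod)
    fix k assume "k \<in> ?K"
    then show "(\<lambda>t. ?h k (t k)) \<in> borel_measurable (\<Pi>\<^sub>M k\<in>?K. ?I k)"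
      by (intro measurable_compose[of "\<lambda>t. t k" _ unit_interval_measure "?h k" borel]
          measurable_component_singleton[of k ?K ?I] hm)
  qed
  have "fourier_measure random_phases n = (LINT t|?Q. cnj (character n (?g t)))"
    unfolding fourier_measure_def random_phases_def
    by (rule integral_distr_torus[OF g]) (intro continuous_intros continuous_on_character)
  also have "\<dots> = (LINT t|?Q. (\<Prod>k\<in>?K. ?h k (t k)))"
    unfolding character_def by (simp add: cis_power_int cis_cnj mult_ac)
  also have "\<dots> = (LINT t|distr ?Q (\<Pi>\<^sub>M k\<in>?K. ?I k) (\<lambda>t. restrict t ?K). (\<Prod>k\<in>?K. ?h k (t k)))"
    using prod_hm by (subst integral_distr[OF measurable_restrict_subset]) auto
  also have "\<dots> = (LINT t|(\<Pi>\<^sub>M k\<in>?K. ?I k). (\<Prod>k\<in>?K. ?h k (t k)))"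
    by (subst distr_PiM_restrict_finite) auto
  also have "\<dots> = (\<Prod>k\<in>?K. LINT t|unit_interval_measure. ?h k t)"
  proof (rule product_integral_prod)
    show "integrable unit_interval_measure (?h k)" for k
      using hm prob_space_unit_interval_measure
      by (intro finite_measure.integrable_const_bound[of _ _ 1]) (auto simp: prob_space_def)
  qed simp
  also have "\<dots> = 0"
  proof -
    obtain k where k: "k \<in> ?K" using \<open>n \<noteq> 0\<close> by (metis all_not_in_conv keys_eq_empty)
    then have "(LINT t|unit_interval_measure. ?h k t) = 0"
      by (intro integral_unit_interval_cis) (simp add: in_keys_iff)
    then show ?thesis using k by (intro prod_zero) auto
  qed
  finally show "fourier_measure random_phases n = 0" .
qed

lemma measurable_seq_mult_torus:
  assumes "l \<in> torus" "sets M = sets torus_borel"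
  shows "(\<lambda>x. l \<odot> x) \<in> measurable M torus_borel"
  using assms by (intro measurable_into_torus continuous_intros) (auto intro: seq_mult_torus)

lemma fourier_measure_translate:
  assumes "l \<in> torus" "sets M = sets torus_borel"
  shows "fourier_measure (distr M torus_borel (\<lambda>x. l \<odot> x)) n = cnj (character n l) * fourier_measure M n"
proof -
  have "continuous_on torus (\<lambda>x. cnj (character n x))"
    by (intro continuous_intros continuous_on_character)
  then show ?thesis
    unfolding fourier_measure_def
    by (subst integral_distr_torus[OF measurable_seq_mult_torus[OF assms]]) (auto simp: character_seq_mult)
qed

lemma fourier_measure_0: "prob_space M \<Longrightarrow> fourier_measure M 0 = 1"
  by (simp add: fourier_measure_def prob_space.prob_space)

lemma emeasure_translate_image:
  assumes "l \<in> torus" "sets M = sets torus_borel" "E \<in> sets M"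
  shows "emeasure M ((\<lambda>x. l \<odot> x) ` E) = emeasure (distr M torus_borel (\<lambda>x. seq_cnj l \<odot> x)) E"
proof -
  have "(\<lambda>x. l \<odot> x) ` E = (\<lambda>x. seq_cnj l \<odot> x) -` E \<inter> space M"
  proof (intro equalityI subsetI)
    fix y assume "y \<in> (\<lambda>x. l \<odot> x) ` E"
    then show "y \<in> (\<lambda>x. seq_cnj l \<odot> x) -` E \<inter> space M"
      using assms sets.sets_into_space[OF assms(3)] space_torus_measure[OF assms(2)]
      by (auto simp: seq_mult_cnj_cancel intro: seq_mult_torus)
  next
    fix y assume "y \<in> (\<lambda>x. seq_cnj l \<odot> x) -` E \<inter> space M"
    then show "y \<in> (\<lambda>x. l \<odot> x) ` E"
      using assms(1) by (intro image_eqI[of _ _ "seq_cnj l \<odot> y"]) (auto simp: seq_mult_cnj_cancel)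
  qed
  then show ?thesis
    using assms by (simp add: emeasure_distr measurable_seq_mult_torus seq_cnj_torus)
qed

lemma seq_cnj_seq_cnj [simp]: "seq_cnj (seq_cnj l) = l"
  by (simp add: seq_cnj_def)

text \<open>The coefficient \<open>c\<close> at \<open>n\<close> of a translation-invariant measure satisfies
\<open>c = cnj (character n l) * c\<close> for every \<open>l\<close> on the torus, which forces \<open>c = 0\<close> unless \<open>n = 0\<close>.
Conversely, a translate of a measure with these coefficients has the same coefficients and hence is the same
measure. So existence and uniqueness of Haar measure reduce to the uniqueness of Fourier coefficients.\<close>
lemma is_normalized_haar_iff_fourier:
  "is_normalized_haar M \<longleftrightarrow> sets M = sets torus_borel \<and> prob_space M \<and>
     (\<forall>n. n \<noteq> 0 \<longrightarrow> fourier_measure M n = 0)"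
proof
  assume M: "is_normalized_haar M"
  then have sets: "sets M = sets torus_borel" by (simp add: is_normalized_haar_def)
  then have prob: "prob_space M"
    using M by (intro prob_spaceI) (simp add: space_torus_measure is_normalized_haar_def)
  have "fourier_measure M n = 0" if "n \<noteq> 0" for n
  proof -
    have inv: "distr M torus_borel (\<lambda>x. l \<odot> x) = M" if "l \<in> torus" for l
    proof (rule measure_eqI)
      fix E assume "E \<in> sets (distr M torus_borel (\<lambda>x. l \<odot> x))"
      then show "emeasure (distr M torus_borel (\<lambda>x. l \<odot> x)) E = emeasure M E"
        using emeasure_translate_image[OF seq_cnj_torus[OF that] sets, of E] M seq_cnj_torus[OF that]
        by (simp add: is_normalized_haar_def sets)
    qed (simp add: sets)
    obtain k where k: "k \<in> Poly_Mapping.keys n" using \<open>n \<noteq> 0\<close> by (metis all_not_in_conv keys_eq_empty)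
    define a where "a = Poly_Mapping.lookup n k"
    have "a \<noteq> 0" using k by (simp add: a_def in_keys_iff)
    \<comment> \<open>chosen so that \<open>character n l = -1\<close>\<close>
    define l where "l = (\<lambda>j. if j = k then cis (pi / real_of_int a) else 1)"
    have l: "l \<in> torus" by (simp add: l_def torus_def)
    have "character n l = (\<Prod>j\<in>Poly_Mapping.keys n. if j = k then l k powi a else 1)"
      unfolding character_def by (intro prod.cong) (auto simp: l_def a_def)
    also have "\<dots> = cis (pi / real_of_int a) powi a" using k by (simp add: l_def)
    also have "\<dots> = -1" using \<open>a \<noteq> 0\<close> by (simp add: cis_power_int)
    finally have "fourier_measure M n = - fourier_measure M n"
      using fourier_measure_translate[OF l sets, of n] inv[OF l] by simp
    then show ?thesis by simp
  qed
  then show "sets M = sets torus_borel \<and> prob_space M \<and> (\<forall>n. n \<noteq> 0 \<longrightarrow> fourier_measure M n = 0)"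
    using sets prob by blast
next
  assume *: "sets M = sets torus_borel \<and> prob_space M \<and> (\<forall>n. n \<noteq> 0 \<longrightarrow> fourier_measure M n = 0)"
  then interpret prob_space M by blast
  have inv: "distr M torus_borel (\<lambda>x. l \<odot> x) = M" if "l \<in> torus" for l
  proof (rule torus_measure_eq_if_fourier_measure_eq)
    interpret D: prob_space "distr M torus_borel (\<lambda>x. l \<odot> x)"
      using that * by (intro prob_space_distr measurable_seq_mult_torus) auto
    show "finite_measure (distr M torus_borel (\<lambda>x. l \<odot> x))" "finite_measure M" by unfold_locales
    show "fourier_measure (distr M torus_borel (\<lambda>x. l \<odot> x)) n = fourier_measure M n" for n
      using that * by (cases "n = 0") (auto simp: fourier_measure_translate)
  qed (use * in auto)
  have "emeasure M torus = 1" using emeasure_space_1 * space_torus_measure by metis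
  moreover have "emeasure M ((\<lambda>x. l \<odot> x) ` E) = emeasure M E" if "l \<in> torus" "E \<in> sets M" for l E
    using emeasure_translate_image[of l M E] inv[OF seq_cnj_torus[OF that(1)]] that * by simp
  ultimately show "is_normalized_haar M" using * by (simp add: is_normalized_haar_def)
qed

lemma haar: "sets haar = sets torus_borel" "prob_space haar" "n \<noteq> 0 \<Longrightarrow> fourier_measure haar n = 0"
proof -
  have "is_normalized_haar haar"
    unfolding haar_def
  proof (rule theI)
    show "is_normalized_haar random_phases"
      by (simp add: random_phases is_normalized_haar_iff_fourier)
    fix M assume M: "is_normalized_haar M"
    show "M = random_phases"
    proof (rule torus_measure_eq_if_fourier_measure_eq)
      show "fourier_measure M n = fourier_measure random_phases n" for n
        using M random_phases(2) random_phases(3)[of n] by (cases "n = 0") (auto simp: fourier_measure_0 is_normalized_haar_iff_fourier)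
    qed (use M random_phases in \<open>auto simp: is_normalized_haar_iff_fourier prob_space_def\<close>)
  qed
  then show "sets haar = sets torus_borel" "prob_space haar" "n \<noteq> 0 \<Longrightarrow> fourier_measure haar n = 0"
    by (auto simp: is_normalized_haar_iff_fourier)
qed

lemma finite_measure_haar: "finite_measure haar"
  using haar(2) by (simp add: prob_space_def)

text \<open>Invariance under \<open>y \<mapsto> x y\<inverse>\<close> is read off from the Fourier coefficients as well; it
is what makes convolution with a character computable.\<close>
lemma haar_reflect:
  assumes "x \<in> torus"
  shows "distr haar torus_borel (\<lambda>y. x \<odot> seq_cnj y) = haar" and
    "(\<lambda>y. x \<odot> seq_cnj y) \<in> measurable haar torus_borel"
proof -
  show g: "(\<lambda>y. x \<odot> seq_cnj y) \<in> measurable haar torus_borel"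
    using assms haar(1) by (intro measurable_into_torus continuous_intros) (auto intro: seq_mult_torus seq_cnj_torus)
  show "distr haar torus_borel (\<lambda>y. x \<odot> seq_cnj y) = haar"
  proof (rule torus_measure_eq_if_fourier_measure_eq)
    have D: "prob_space (distr haar torus_borel (\<lambda>y. x \<odot> seq_cnj y))"
      by (rule prob_space.prob_space_distr[OF haar(2) g])
    then show "finite_measure (distr haar torus_borel (\<lambda>y. x \<odot> seq_cnj y))"
      by (simp add: prob_space_def)
    show "fourier_measure (distr haar torus_borel (\<lambda>y. x \<odot> seq_cnj y)) n = fourier_measure haar n" for n
    proof (cases "n = 0")
      case False
      have "fourier_measure (distr haar torus_borel (\<lambda>y. x \<odot> seq_cnj y)) n
          = (LINT y|haar. cnj (character n (x \<odot> seq_cnj y)))"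
        unfolding fourier_measure_def
        by (intro integral_distr_torus g continuous_intros continuous_on_character)
      also have "\<dots> = cnj (character n x) * (LINT y|haar. character n y)"
        by (simp add: character_seq_mult character_seq_cnj)
      also have "(LINT y|haar. character n y) = 0"
        using False haar(3)[of "- n"] by (simp add: integral_character_eq_fourier_measure haar(1))
      finally show ?thesis using haar(3)[OF False] by simp
    qed (simp add: fourier_measure_0 D haar(2))
  qed (simp_all add: finite_measure_haar haar(1))
qed

section \<open>The algebra\<close>

abbreviation nonneg_freqs :: "(nat \<Rightarrow>\<^sub>0 int) set" where
  "nonneg_freqs \<equiv> {n. 0 \<le> tau n}"

lemma measure_torus_prob: "prob_space M \<Longrightarrow> sets M = sets torus_borel \<Longrightarrow> measure M torus = 1"
  using prob_space.prob_space[of M] by (simp add: space_torus_measure)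

lemma fourier_fun_close:
  assumes f: "continuous_on torus f" and g: "continuous_on torus g"
    and le: "\<And>x. x \<in> torus \<Longrightarrow> cmod (f x - g x) \<le> e"
  shows "cmod (fourier_fun f n - fourier_fun g n) \<le> e"
proof -
  have "cmod (fourier_fun f n - fourier_fun g n) \<le> e * measure haar torus"
    unfolding fourier_fun_def
  proof (intro integral_torus_close finite_measure_haar haar(1) continuous_intros f g continuous_on_character)
    fix x assume x: "x \<in> torus"
    have "f x * cnj (character n x) - g x * cnj (character n x) = (f x - g x) * cnj (character n x)"
      by (simp add: algebra_simps)
    then show "cmod (f x * cnj (character n x) - g x * cnj (character n x)) \<le> e"
      using le[OF x] by (simp add: norm_mult norm_character[OF x])
  qed
  then show ?thesis using measure_torus_prob[OF haar(2,1)] by simp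
qed

lemma fourier_fun_cong: "(\<And>x. x \<in> torus \<Longrightarrow> f x = g x) \<Longrightarrow> fourier_fun f n = fourier_fun g n"
  unfolding fourier_fun_def
  by (intro Bochner_Integration.integral_cong refl) (simp add: space_torus_measure[OF haar(1)])

lemma fourier_fun_trig_poly:
  assumes "trig_poly S p" "m \<notin> S"
  shows "fourier_fun p m = 0"
  using assms(1)
proof (induction rule: trig_poly.induct)
  case (monomial n c)
  then have "n - m \<noteq> 0" using assms(2) by auto
  have "fourier_fun (\<lambda>x. c * character n x) m = (LINT x|haar. c * character (n - m) x)"
    unfolding fourier_fun_def
  proof (intro Bochner_Integration.integral_cong refl)
    fix x assume "x \<in> space haar"
    then have x: "x \<in> torus" by (simp add: space_torus_measure[OF haar(1)])
    then have "character (n - m) x = character n x * cnj (character m x)"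
      using character_add[of x n "- m"] by (simp add: torus_nonzero character_uminus_torus)
    then show "c * character n x * cnj (character m x) = c * character (n - m) x" by simp
  qed
  also have "\<dots> = 0"
    using haar(3)[of "- (n - m)"] \<open>n - m \<noteq> 0\<close>
    by (simp add: integral_character_eq_fourier_measure haar(1) del: minus_diff_eq)
  finally show ?case .
next
  case (add p q)
  have "integrable haar (\<lambda>x. p x * cnj (character m x))" "integrable haar (\<lambda>x. q x * cnj (character m x))"
    using add.hyps trig_poly_continuous
    by (auto intro!: continuous_torus_integrable finite_measure_haar haar(1) continuous_intros continuous_on_character)
  then show ?case using add.IH by (simp add: fourier_fun_def ring_distribs)
next
  case (cong p q)
  then show ?case using fourier_fun_cong[of p q m] by simp
qed

lemma continuous_on_reflect:
  assumes "continuous_on torus f" "x \<in> torus"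
  shows "continuous_on torus (\<lambda>y. f (x \<odot> seq_cnj y))"
  using assms(2)
  by (intro continuous_on_compose2[OF assms(1)] continuous_on_seq_mult continuous_on_seq_cnj
      continuous_on_const continuous_on_id) (auto intro: seq_mult_torus seq_cnj_torus)

text \<open>Reflecting the variable turns the convolution with a character into the character
  itself, scaled by a Fourier coefficient; for negative frequencies this coefficient is zero.\<close>
lemma trig_poly_convolution:
  assumes f: "f \<in> A_tau" and q: "trig_poly UNIV q"
  shows "trig_poly nonneg_freqs (\<lambda>x. LINT y|haar. f (x \<odot> seq_cnj y) * q y)"
  using q
proof (induction rule: trig_poly.induct)
  case (monomial n c)
  have cont_f: "continuous_on torus f" using f by (simp add: A_tau_def)
  have eq: "(LINT y|haar. f (x \<odot> seq_cnj y) * (c * character n y)) = c * fourier_fun f n * character n x"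
    if x: "x \<in> torus" for x
  proof -
    have shift: "x \<odot> seq_cnj (x \<odot> seq_cnj y) = y" for y
      using seq_mult_cnj_cancel(2)[OF x, of y] by (simp add: seq_mult_def seq_cnj_def)
    have "(LINT y|haar. f (x \<odot> seq_cnj y) * (c * character n y))
        = (LINT y|distr haar torus_borel (\<lambda>y. x \<odot> seq_cnj y). f (x \<odot> seq_cnj y) * (c * character n y))"
      by (simp only: haar_reflect(1)[OF x])
    also have "\<dots> = (LINT y|haar. f (x \<odot> seq_cnj (x \<odot> seq_cnj y)) * (c * character n (x \<odot> seq_cnj y)))"
    proof (rule integral_distr_torus[OF haar_reflect(2)[OF x]])
      have "continuous_on torus (\<lambda>y. f (x \<odot> seq_cnj y))"
        by (rule continuous_on_reflect[OF cont_f x])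
      then show "continuous_on torus (\<lambda>y. f (x \<odot> seq_cnj y) * (c * character n y))"
        by (intro continuous_intros continuous_on_character)
    qed
    also have "\<dots> = (LINT y|haar. (c * character n x) * (f y * cnj (character n y)))"
      by (simp only: shift character_seq_mult character_seq_cnj mult_ac)
    also have "\<dots> = c * fourier_fun f n * character n x"
      by (simp add: fourier_fun_def)
    finally show ?thesis .
  qed
  have "trig_poly nonneg_freqs (\<lambda>x. c * fourier_fun f n * character n x)"
  proof (cases "tau n < 0")
    case True
    then show ?thesis using f trig_poly_const[of nonneg_freqs 0] by (simp add: A_tau_def)
  next
    case False
    then show ?thesis by (intro trig_poly.monomial) simp
  qed
  then show ?case by (rule trig_poly.cong) (simp add: eq)
next
  case (add p q)
  have cont_f: "continuous_on torus f" using f by (simp add: A_tau_def)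
  have "integrable haar (\<lambda>y. f (x \<odot> seq_cnj y) * r y)" if "x \<in> torus" "trig_poly UNIV r" for x r
  proof (intro continuous_torus_integrable finite_measure_haar haar(1) continuous_on_mult)
    show "continuous_on torus (\<lambda>y. f (x \<odot> seq_cnj y))"
      by (rule continuous_on_reflect[OF cont_f that(1)])
    show "continuous_on torus r" using that(2) by (rule trig_poly_continuous)
  qed
  then have "(LINT y|haar. f (x \<odot> seq_cnj y) * p y) + (LINT y|haar. f (x \<odot> seq_cnj y) * q y) =
     (LINT y|haar. f (x \<odot> seq_cnj y) * (p y + q y))" if "x \<in> torus" for x
    using that add.hyps by (simp add: ring_distribs)
  then show ?case by (rule trig_poly.cong[OF trig_poly.add[OF add.IH]])
next
  case (cong p q)
  have "(LINT y|haar. f (x \<odot> seq_cnj y) * p y) = (LINT y|haar. f (x \<odot> seq_cnj y) * q y)" for x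
    using cong.hyps(2)
    by (intro Bochner_Integration.integral_cong refl) (simp add: space_torus_measure[OF haar(1)])
  then show ?case using cong.IH by simp
qed

abbreviation torus_one :: "nat \<Rightarrow> complex" where
  "torus_one \<equiv> \<lambda>_. 1"

lemma torus_one: "torus_one \<in> torus"
  by (simp add: torus_def)

lemma uniformly_continuous_translates:
  fixes f :: "(nat \<Rightarrow> complex) \<Rightarrow> complex"
  assumes f: "continuous_on torus f" and "e > 0"
  obtains d where "d > 0"
    "\<And>x y. x \<in> torus \<Longrightarrow> y \<in> torus \<Longrightarrow> dist y torus_one < d \<Longrightarrow> cmod (f x - f (x \<odot> seq_cnj y)) < e"
proof -
  let ?g = "\<lambda>z. f (fst z \<odot> seq_cnj (snd z))"
  have "continuous_on (torus \<times> torus) ?g"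
    by (intro continuous_on_compose2[OF f] continuous_on_seq_mult continuous_on_seq_cnj
        continuous_on_fst continuous_on_snd continuous_on_id) (auto intro!: seq_mult_torus seq_cnj_torus)
  then have "uniformly_continuous_on (torus \<times> torus) ?g"
    by (intro compact_uniformly_continuous compact_Times compact_torus)
  then obtain d where d: "d > 0"
    "\<And>z w. z \<in> torus \<times> torus \<Longrightarrow> w \<in> torus \<times> torus \<Longrightarrow> dist w z < d \<Longrightarrow> dist (?g w) (?g z) < e"
    unfolding uniformly_continuous_on_def using \<open>e > 0\<close> by metis
  show ?thesis
  proof (rule that[OF d(1)])
    fix x y assume "x \<in> torus" "y \<in> torus" "dist y torus_one < d"
    moreover from this have "dist (?g (x, y)) (?g (x, torus_one)) < e"
      using torus_one by (intro d(2)) (auto simp: dist_Pair_Pair)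
    moreover have "x \<odot> seq_cnj torus_one = x" by (simp add: seq_mult_def seq_cnj_def)
    ultimately show "cmod (f x - f (x \<odot> seq_cnj y)) < e" by (simp add: dist_norm norm_minus_commute)
  qed
qed

text \<open>Finitely many translates of the open set where \<open>b > 0\<close> cover the compact torus, and they all
  have the same Haar measure.\<close>
lemma haar_integral_pos:
  fixes b :: "(nat \<Rightarrow> complex) \<Rightarrow> real"
  assumes b: "continuous_on UNIV b" "\<And>x. b x \<ge> 0" "b torus_one > 0"
  shows "(LINT x|haar. b x) > 0"
proof (rule ccontr)
  assume "\<not> ?thesis"
  then have zero: "(LINT x|haar. b x) = 0"
    using integral_nonneg_AE[of b haar] b(2) by (simp add: order_less_le)
  let ?V = "\<lambda>l. {x. b (l \<odot> seq_cnj x) > 0}"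
  have cont: "continuous_on UNIV (\<lambda>x. b (l \<odot> seq_cnj x))" for l
    by (intro continuous_on_compose2[OF b(1)] continuous_on_seq_mult continuous_on_seq_cnj
        continuous_on_const continuous_on_id) auto
  have "open (?V l)" for l
    using open_Collect_less[OF continuous_on_const cont] by simp
  moreover have "torus \<subseteq> (\<Union>l\<in>torus. ?V l)"
  proof
    fix x assume x: "x \<in> torus"
    then have "x \<odot> seq_cnj x = torus_one"
      using seq_mult_cnj_cancel(2)[OF x, of torus_one] by (simp add: seq_mult_def)
    then show "x \<in> (\<Union>l\<in>torus. ?V l)" using x b(3) by (auto intro!: bexI[of _ x])
  qed
  ultimately obtain L where L: "L \<subseteq> torus" "finite L" "torus \<subseteq> (\<Union>l\<in>L. ?V l)"
    using compactE_image[OF compact_torus, of torus ?V] by metis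
  have null: "AE x in haar. \<not> b (l \<odot> seq_cnj x) > 0" if l: "l \<in> torus" for l
  proof -
    have cont': "continuous_on torus (\<lambda>x. b (l \<odot> seq_cnj x))" using cont continuous_on_subset by blast
    have "(LINT x|haar. b (l \<odot> seq_cnj x)) = (LINT x|distr haar torus_borel (\<lambda>x. l \<odot> seq_cnj x). b x)"
      using b(1) continuous_on_subset
      by (subst integral_distr[OF haar_reflect(2)[OF l]]) (auto intro!: continuous_torus_measurable)
    also have "\<dots> = 0" by (simp only: haar_reflect(1)[OF l] zero)
    finally have "AE x in haar. b (l \<odot> seq_cnj x) = 0"
      using b(2) continuous_torus_integrable[OF finite_measure_haar haar(1) cont']
      by (subst (asm) integral_nonneg_eq_0_iff_AE) auto
    then show ?thesis by eventually_elim simp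
  qed
  have "AE x in haar. \<forall>l\<in>L. \<not> b (l \<odot> seq_cnj x) > 0"
    using L null by (intro AE_finite_allI) auto
  then have "AE x in haar. False"
  proof (rule AE_mp, intro AE_I2 impI)
    fix x assume "x \<in> space haar" "\<forall>l\<in>L. \<not> b (l \<odot> seq_cnj x) > 0"
    then show False using L(3) space_torus_measure[OF haar(1)] by auto
  qed
  then show False using prob_space.AE_False[OF haar(2)] by simp
qed

text \<open>With \<open>w\<close> a nonnegative continuous bump of integral one near the identity, the convolution of
  \<open>f\<close> with \<open>w\<close> is uniformly close to \<open>f\<close>. Replacing \<open>w\<close> by a nearby trigonometric polynomial makes
  the convolution a trigonometric polynomial whose frequencies all occur in \<open>f\<close>.\<close>
lemma A_tau_approx:
  assumes f: "f \<in> A_tau" and e: "e > 0"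
  obtains p where "trig_poly nonneg_freqs p" "\<And>x. x \<in> torus \<Longrightarrow> cmod (f x - p x) < e"
proof -
  have cont_f: "continuous_on torus f" using f by (simp add: A_tau_def)
  obtain F where F: "F > 0" "\<And>x. x \<in> torus \<Longrightarrow> cmod (f x) \<le> F"
    using continuous_torus_bounded[OF cont_f] by metis
  obtain d where d: "d > 0"
    "\<And>x y. x \<in> torus \<Longrightarrow> y \<in> torus \<Longrightarrow> dist y torus_one < d \<Longrightarrow> cmod (f x - f (x \<odot> seq_cnj y)) < e / 3"
    using uniformly_continuous_translates[OF cont_f, of "e / 3"] e by (metis divide_pos_pos zero_less_numeral)
  define b where "b = (\<lambda>y. max 0 (1 - dist y torus_one / d))"
  define I where "I = (LINT y|haar. b y)"
  define w where "w = (\<lambda>y. b y / I)"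
  have b: "continuous_on UNIV b" "\<And>y. b y \<ge> 0" "b torus_one > 0"
    unfolding b_def using d(1) by (auto intro!: continuous_intros)
  have "I > 0" unfolding I_def by (rule haar_integral_pos[OF b])
  have w: "continuous_on torus w" "\<And>y. w y \<ge> 0" "(LINT y|haar. w y) = 1"
    unfolding w_def using \<open>I > 0\<close> b I_def
    by (auto intro!: continuous_intros continuous_on_subset[OF b(1)])
  have w_far: "w y = 0" if "\<not> dist y torus_one < d" for y
    using that d(1) by (simp add: w_def b_def max_def field_simps)
  have cont_w: "continuous_on torus (\<lambda>y. complex_of_real (w y))"
    by (intro continuous_intros w)
  obtain q where q: "trig_poly UNIV q" "\<And>y. y \<in> torus \<Longrightarrow> cmod (of_real (w y) - q y) < e / (3 * F)"
    using trig_poly_dense[OF cont_w, of "e / (3 * F)"] e F(1) by auto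
  show ?thesis
  proof (rule that[OF trig_poly_convolution[OF f q(1)]])
    fix x assume x: "x \<in> torus"
    let ?f = "\<lambda>y. f (x \<odot> seq_cnj y)"
    have cont_fx: "continuous_on torus ?f"
      by (rule continuous_on_reflect[OF cont_f x])
    note int = continuous_torus_integrable[OF finite_measure_haar haar(1)]
    have "f x = (LINT y|haar. f x * of_real (w y))"
      using w(3) by (simp add: integral_complex_of_real)
    moreover have "(LINT y|haar. f x * of_real (w y) - ?f y * of_real (w y)) =
        (LINT y|haar. f x * of_real (w y)) - (LINT y|haar. ?f y * of_real (w y))"
      by (intro Bochner_Integration.integral_diff int continuous_on_mult continuous_on_const cont_fx cont_w)
    ultimately have "f x - (LINT y|haar. ?f y * of_real (w y)) = (LINT y|haar. (f x - ?f y) * of_real (w y))"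
      by (simp only: left_diff_distrib)
    also have "cmod \<dots> \<le> (LINT y|haar. cmod ((f x - ?f y) * of_real (w y)))"
      by (rule integral_norm_bound)
    also have "\<dots> \<le> (LINT y|haar. e / 3 * w y)"
    proof (rule integral_mono)
      fix y assume "y \<in> space haar"
      then have y: "y \<in> torus" by (simp add: space_torus_measure[OF haar(1)])
      have "cmod (f x - ?f y) * w y \<le> e / 3 * w y"
      proof (cases "dist y torus_one < d")
        case True
        then show ?thesis using d(2)[OF x y] w(2)[of y] by (intro mult_right_mono) auto
      qed (simp add: w_far)
      then show "cmod ((f x - ?f y) * of_real (w y)) \<le> e / 3 * w y"
        using w(2)[of y] by (simp add: norm_mult)
    qed (intro int continuous_intros cont_fx cont_w w)+
    also have "\<dots> = e / 3" using w(3) by simp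
    finally have 1: "cmod (f x - (LINT y|haar. ?f y * of_real (w y))) \<le> e / 3" .
    have "cmod ((LINT y|haar. ?f y * of_real (w y)) - (LINT y|haar. ?f y * q y)) \<le> e / 3 * measure haar torus"
    proof (intro integral_torus_close finite_measure_haar haar(1) continuous_on_mult cont_fx cont_w
        trig_poly_continuous[OF q(1)])
      fix y assume y: "y \<in> torus"
      have "cmod (?f y * of_real (w y) - ?f y * q y) = cmod (?f y) * cmod (of_real (w y) - q y)"
        by (simp add: right_diff_distrib flip: norm_mult)
      also have "\<dots> \<le> F * (e / (3 * F))"
        using F(1) F(2)[OF seq_mult_torus[OF x seq_cnj_torus[OF y]]] less_imp_le[OF q(2)[OF y]]
        by (intro mult_mono) auto
      finally show "cmod (?f y * of_real (w y) - ?f y * q y) \<le> e / 3" using F(1) by simp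
    qed
    then have 2: "cmod ((LINT y|haar. ?f y * of_real (w y)) - (LINT y|haar. ?f y * q y)) \<le> e / 3"
      using measure_torus_prob[OF haar(2,1)] by simp
    show "cmod (f x - (LINT y|haar. ?f y * q y)) < e"
      using 1 2 norm_triangle_ineq[of "f x - (LINT y|haar. ?f y * of_real (w y))"
          "(LINT y|haar. ?f y * of_real (w y)) - (LINT y|haar. ?f y * q y)"] e by simp
  qed
qed

text \<open>Fourier coefficients are continuous in the uniform norm, so vanishing at the negative frequencies
survives uniform limits.\<close>
lemma A_tau_if_approximable:
  assumes f: "f \<in> extensional torus" "continuous_on torus f"
    and approx: "\<And>e. e > 0 \<Longrightarrow> \<exists>g. continuous_on torus g \<and>
      (\<forall>n. tau n < 0 \<longrightarrow> fourier_fun g n = 0) \<and> (\<forall>x\<in>torus. cmod (f x - g x) \<le> e)"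
  shows "f \<in> A_tau"
proof -
  have "fourier_fun f n = 0" if "tau n < 0" for n
  proof -
    have "cmod (fourier_fun f n) \<le> 0"
    proof (rule field_le_epsilon)
      fix e :: real assume "e > 0"
      then obtain g where "continuous_on torus g" "fourier_fun g n = 0" "\<forall>x\<in>torus. cmod (f x - g x) \<le> e"
        using approx \<open>tau n < 0\<close> by blast
      then show "cmod (fourier_fun f n) \<le> 0 + e"
        using fourier_fun_close[OF f(2), of g e n] by simp
    qed
    then show ?thesis by simp
  qed
  then show ?thesis using f by (simp add: A_tau_def)
qed

lemma trig_poly_in_A_tau:
  assumes "trig_poly nonneg_freqs p"
  shows "(\<lambda>x\<in>torus. p x) \<in> A_tau"
proof -
  have "continuous_on torus (\<lambda>x\<in>torus. p x) = continuous_on torus p"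
    by (rule continuous_on_cong) auto
  moreover have "fourier_fun (\<lambda>x\<in>torus. p x) n = fourier_fun p n" for n
    by (rule fourier_fun_cong) simp
  ultimately show ?thesis
    using assms trig_poly_continuous fourier_fun_trig_poly[OF assms] by (auto simp: A_tau_def)
qed

text \<open>Simultaneous approximation of two functions and of their product. Statements about products in the algebra
are thereby reduced to trigonometric polynomials with nonnegative frequencies, which are closed under
multiplication because these frequencies form a semigroup.\<close>
lemma A_tau_approx_product:
  assumes f: "f \<in> A_tau" and g: "g \<in> A_tau" and e: "e > 0"
  obtains p q where "trig_poly nonneg_freqs p" "trig_poly nonneg_freqs q"
    "\<And>x. x \<in> torus \<Longrightarrow> cmod (f x - p x) \<le> e" "\<And>x. x \<in> torus \<Longrightarrow> cmod (g x - q x) \<le> e"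
    "\<And>x. x \<in> torus \<Longrightarrow> cmod (f x * g x - p x * q x) \<le> e"
proof -
  have cont: "continuous_on torus f" "continuous_on torus g" using f g by (auto simp: A_tau_def)
  obtain F where F: "F > 0" "\<And>x. x \<in> torus \<Longrightarrow> cmod (f x) \<le> F"
    using continuous_torus_bounded[OF cont(1)] by metis
  obtain G where G: "G > 0" "\<And>x. x \<in> torus \<Longrightarrow> cmod (g x) \<le> G"
    using continuous_torus_bounded[OF cont(2)] by metis
  define d where "d = min 1 (e / (F + G + 1))"
  have FG: "F + G + 1 \<ge> 1" using F(1) G(1) by simp
  then have d: "d > 0" "d \<le> 1" "d * (F + G + 1) \<le> e"
    using e by (simp_all add: d_def min_le_iff_disj flip: pos_le_divide_eq)
  have "d \<le> d * (F + G + 1)" using d(1) FG by simp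
  then have "d \<le> e" using d(3) by linarith
  obtain p where p: "trig_poly nonneg_freqs p" "\<And>x. x \<in> torus \<Longrightarrow> cmod (f x - p x) < d"
    using A_tau_approx[OF f d(1)] by blast
  obtain q where q: "trig_poly nonneg_freqs q" "\<And>x. x \<in> torus \<Longrightarrow> cmod (g x - q x) < d"
    using A_tau_approx[OF g d(1)] by blast
  have "cmod (f x * g x - p x * q x) \<le> e" if x: "x \<in> torus" for x
  proof -
    have "cmod (p x) \<le> F + 1"
      using norm_triangle_sub[of "p x" "f x"] p(2)[OF x] F(2)[OF x] d(2) by (simp add: norm_minus_commute)
    have "f x * g x - p x * q x = (f x - p x) * g x + p x * (g x - q x)" by (simp add: algebra_simps)
    also have "cmod \<dots> \<le> cmod (f x - p x) * cmod (g x) + cmod (p x) * cmod (g x - q x)"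
      by (rule order_trans[OF norm_triangle_ineq]) (simp add: norm_mult)
    also have "\<dots> \<le> d * G + (F + 1) * d"
      using p(2)[OF x] q(2)[OF x] G(2)[OF x] G(1) F(1) d(1) \<open>cmod (p x) \<le> F + 1\<close>
      by (intro add_mono mult_mono) auto
    also have "\<dots> \<le> e" using d(3) by (simp add: algebra_simps)
    finally show ?thesis .
  qed
  moreover have "cmod (f x - p x) \<le> e" "cmod (g x - q x) \<le> e" if "x \<in> torus" for x
    using p(2)[OF that] q(2)[OF that] \<open>d \<le> e\<close> by linarith+
  ultimately show ?thesis using that p(1) q(1) by blast
qed

lemma A_tau_mult:
  assumes f: "f \<in> A_tau" and g: "g \<in> A_tau"
  shows "(\<lambda>x\<in>torus. f x * g x) \<in> A_tau"
proof (rule A_tau_if_approximable)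
  have cont: "continuous_on torus f" "continuous_on torus g" using f g by (auto simp: A_tau_def)
  have "continuous_on torus (\<lambda>x\<in>torus. f x * g x) = continuous_on torus (\<lambda>x. f x * g x)"
    by (rule continuous_on_cong) auto
  then show "continuous_on torus (\<lambda>x\<in>torus. f x * g x)" using cont by (simp add: continuous_on_mult)
  fix e :: real assume e: "e > 0"
  obtain p q where p: "trig_poly nonneg_freqs p" and q: "trig_poly nonneg_freqs q"
    and le: "\<And>x. x \<in> torus \<Longrightarrow> cmod (f x * g x - p x * q x) \<le> e"
    using A_tau_approx_product[OF f g e] by metis
  have pq: "trig_poly nonneg_freqs (\<lambda>x. p x * q x)"
    by (rule trig_poly_mult[OF _ p q]) (simp add: tau_add)
  then show "\<exists>h. continuous_on torus h \<and> (\<forall>n. tau n < 0 \<longrightarrow> fourier_fun h n = 0) \<and>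
      (\<forall>x\<in>torus. cmod ((\<lambda>x\<in>torus. f x * g x) x - h x) \<le> e)"
    using trig_poly_continuous[OF pq] fourier_fun_trig_poly[OF pq] le
    by (intro exI[of _ "\<lambda>x. p x * q x"]) auto
qed simp

lemma A_tau_const: "(\<lambda>x\<in>torus. c) \<in> A_tau"
  by (intro trig_poly_in_A_tau trig_poly_const) simp

lemma A_tau_scale:
  assumes "f \<in> A_tau"
  shows "(\<lambda>x\<in>torus. c * f x) \<in> A_tau"
  using A_tau_mult[OF A_tau_const[of c] assms] by (simp cong: restrict_cong)

lemma A_tau_add:
  assumes f: "f \<in> A_tau" and g: "g \<in> A_tau"
  shows "(\<lambda>x\<in>torus. f x + g x) \<in> A_tau"
proof -
  have cont: "continuous_on torus f" "continuous_on torus g" using f g by (auto simp: A_tau_def)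
  have "continuous_on torus (\<lambda>x\<in>torus. f x + g x) = continuous_on torus (\<lambda>x. f x + g x)"
    by (rule continuous_on_cong) auto
  moreover have "fourier_fun (\<lambda>x\<in>torus. f x + g x) n = fourier_fun f n + fourier_fun g n" for n
  proof -
    have "integrable haar (\<lambda>x. h x * cnj (character n x))" if "continuous_on torus h" for h
      by (intro continuous_torus_integrable finite_measure_haar haar(1) continuous_intros
          continuous_on_character that)
    then have "fourier_fun (\<lambda>x. f x + g x) n = fourier_fun f n + fourier_fun g n"
      using cont by (simp add: fourier_fun_def ring_distribs)
    then show ?thesis using fourier_fun_cong[of "\<lambda>x\<in>torus. f x + g x" "\<lambda>x. f x + g x"] by simp
  qed
  ultimately show ?thesis using f g cont by (simp add: A_tau_def continuous_on_add)
qed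

section \<open>Poisson measures\<close>

lemma integral_unit_interval_continuous:
  fixes f :: "real \<Rightarrow> complex"
  assumes "continuous_on {0..1} f"
  shows "(LINT t|unit_interval_measure. f t) = integral {0..1} f"
proof -
  have "(LINT t|unit_interval_measure. f t) = (LINT t|lborel. indicator {0..1} t *\<^sub>R f t)"
    unfolding unit_interval_measure_def by (rule integral_restrict_space) simp
  then show ?thesis
    using set_borel_integral_eq_integral(2)[OF borel_integrable_atLeastAtMost'[OF assms]]
    by (simp add: set_lebesgue_integral_def)
qed

lemma holomorphic_mean_value:
  assumes F: "F holomorphic_on cball 0 r" and "r > 0"
  shows "(LINT t|unit_interval_measure. F (of_real r * cis (2 * pi * t))) = F 0"
proof -
  have circle: "circlepath 0 r t = of_real r * cis (2 * pi * t)" for t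
    by (simp add: circlepath cis_conv_exp mult_ac)
  have "((\<lambda>u. F u / (u - 0)) has_contour_integral (2 * of_real pi * \<i> * F 0)) (circlepath 0 r)"
    using \<open>r > 0\<close> by (intro Cauchy_integral_circlepath_simple F) simp
  then have "((\<lambda>t. 2 * of_real pi * \<i> * F (of_real r * cis (2 * pi * t)))
      has_integral (2 * of_real pi * \<i> * F 0)) {0..1}"
    unfolding has_contour_integral_def
  proof (rule has_integral_eq[rotated])
    fix t :: real assume "t \<in> {0..1}"
    then show "F (circlepath 0 r t) / (circlepath 0 r t - 0) *
        vector_derivative (circlepath 0 r) (at t within {0..1}) =
        2 * of_real pi * \<i> * F (of_real r * cis (2 * pi * t))"
      using \<open>r > 0\<close> by (simp add: vector_derivative_circlepath01 circle cis_conv_exp field_simps)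
  qed
  then have "((\<lambda>t. F (of_real r * cis (2 * pi * t))) has_integral F 0) {0..1}"
    by (simp add: has_integral_mult_right_iff)
  moreover have "continuous_on {0..1} (\<lambda>t. F (of_real r * cis (2 * pi * t)))"
    by (rule continuous_on_compose2[OF holomorphic_on_imp_continuous_on[OF F]])
       (use \<open>r > 0\<close> in \<open>auto simp: cis_conv_exp norm_mult intro!: continuous_intros\<close>)
  ultimately show ?thesis by (simp add: integral_unit_interval_continuous integral_unique)
qed

lemma AE_unit_interval_interior: "AE t in unit_interval_measure. 0 < t \<and> t < 1"
proof -
  have "AE t in lborel. t \<in> {0..1} \<longrightarrow> 0 < t \<and> t < (1::real)"
    using AE_lborel_singleton[of "0::real"] AE_lborel_singleton[of "1::real"]
    by eventually_elim auto
  then show ?thesis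
    unfolding unit_interval_measure_def by (subst AE_restrict_space_iff) auto
qed

lemma Re_cayley_nonneg:
  assumes "cmod w < 1"
  shows "Re ((1 + w) / (1 - w)) \<ge> 0"
proof -
  have "(Re w)\<^sup>2 + (Im w)\<^sup>2 \<le> 1"
    using assms by (simp add: cmod_def)
  then have "(1 + Re w) * (1 - Re w) + Im w * (- Im w) \<ge> 0"
    by (simp add: power2_eq_square algebra_simps)
  then show ?thesis by (simp add: Re_divide)
qed

lemma cayley_cis:
  assumes "sin x \<noteq> 0"
  shows "(1 + cis (2 * x)) / (1 - cis (2 * x)) = \<i> * of_real (cot x)" "cis (2 * x) \<noteq> 1"
proof -
  have w: "cis (2 * x) = cis x * cis x" by (simp add: cis_mult)
  have one: "1 = cis x * cis (- x)" by (simp add: cis_mult)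
  have plus: "1 + cis (2 * x) = cis x * (2 * of_real (cos x))"
    unfolding w by (subst (1) one) (simp add: complex_eq_iff algebra_simps)
  have minus: "1 - cis (2 * x) = cis x * (- 2 * \<i> * of_real (sin x))"
    unfolding w by (subst (1) one) (simp add: complex_eq_iff algebra_simps)
  show "cis (2 * x) \<noteq> 1"
  proof
    assume "cis (2 * x) = 1"
    then show False using minus assms by simp
  qed
  have "(1 + cis (2 * x)) / (1 - cis (2 * x)) = (2 * of_real (cos x)) / (- 2 * \<i> * of_real (sin x))"
    unfolding plus minus by (simp del: mult_minus_left)
  also have "\<dots> = \<i> * of_real (cot x)"
    using assms by (simp add: cot_def field_simps)
  finally show "(1 + cis (2 * x)) / (1 - cis (2 * x)) = \<i> * of_real (cot x)" .
qed

text \<open>The Cayley transform \<open>w \<mapsto> (1 + w) / (1 - w)\<close> maps the unit disc onto the right half-plane and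
  \<open>cis (2 \<pi> t)\<close> to \<open>\<i> cot (\<pi> t)\<close>. So the integral is the mean over the unit circle of
  the bounded holomorphic function \<open>exp (- a (1 + w) / (1 - w))\<close>, which has the value \<open>exp (- a)\<close> at
  the origin. In other words, \<open>cot (\<pi> t)\<close> has the Cauchy distribution.\<close>
lemma integral_cis_cot_nonneg:
  assumes a: "a \<ge> 0"
  shows "(LINT t|unit_interval_measure. cis (- a * cot (pi * t))) = of_real (exp (- a))"
proof -
  interpret prob_space unit_interval_measure by (rule prob_space_unit_interval_measure)
  define F where "F = (\<lambda>w::complex. exp (- of_real a * ((1 + w) / (1 - w))))"
  define r where "r = (\<lambda>i. 1 - inverse (real (Suc (Suc i))))"
  have r: "0 < r i" "r i < 1" for i
    by (auto simp: r_def field_simps)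
  have r_lim: "r \<longlonglongrightarrow> 1"
    unfolding r_def using tendsto_diff[OF tendsto_const LIMSEQ_Suc[OF LIMSEQ_inverse_real_of_nat], of 1] by simp
  have F_bound: "cmod (F w) \<le> 1" if "cmod w < 1" for w
  proof -
    have "- a * Re ((1 + w) / (1 - w)) \<le> 0" using a Re_cayley_nonneg[OF that] by simp
    moreover have "Re (- of_real a * z) = - a * Re z" for z by simp
    ultimately show ?thesis unfolding F_def norm_exp_eq_Re by (simp only: exp_le_one_iff)
  qed
  have meas: "(\<lambda>t. F (of_real (r i) * cis (2 * pi * t))) \<in> borel_measurable unit_interval_measure" for i
  proof (rule borel_measurable_continuous_on[OF _ measurable_unit_interval])
    have "of_real (r i) * cis (2 * pi * t) \<noteq> 1" for t
    proof
      assume "of_real (r i) * cis (2 * pi * t) = 1"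
      then have "cmod (of_real (r i) * cis (2 * pi * t)) = 1" by simp
      then show False using r[of i] by (simp add: norm_mult)
    qed
    then show "continuous_on UNIV (\<lambda>t. F (of_real (r i) * cis (2 * pi * t)))"
      unfolding F_def by (auto simp: cis_conv_exp intro!: continuous_intros)
  qed
  have "(\<lambda>i. LINT t|unit_interval_measure. F (of_real (r i) * cis (2 * pi * t)))
      \<longlonglongrightarrow> (LINT t|unit_interval_measure. cis (- a * cot (pi * t)))"
  proof (rule integral_dominated_convergence[where w="\<lambda>_. 1"])
    have "(\<lambda>t. cot (pi * t)) \<in> borel_measurable unit_interval_measure"
      unfolding cot_def by measurable
    then show "(\<lambda>t. cis (- a * cot (pi * t))) \<in> borel_measurable unit_interval_measure"
      by (intro borel_measurable_continuous_on[where f="\<lambda>s. cis (- a * s)"])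
         (auto simp: cis_conv_exp intro!: continuous_intros)
    show "AE t in unit_interval_measure. (\<lambda>i. F (of_real (r i) * cis (2 * pi * t))) \<longlonglongrightarrow> cis (- a * cot (pi * t))"
      using AE_unit_interval_interior
    proof eventually_elim
      case (elim t)
      then have "sin (pi * t) > 0" by (intro sin_gt_zero) auto
      then have w: "(1 + cis (2 * pi * t)) / (1 - cis (2 * pi * t)) = \<i> * of_real (cot (pi * t))"
        "cis (2 * pi * t) \<noteq> 1"
        using cayley_cis[of "pi * t"] by (simp_all add: mult.assoc)
      have "(\<lambda>i. of_real (r i) * cis (2 * pi * t)) \<longlonglongrightarrow> of_real 1 * cis (2 * pi * t)"
        by (intro tendsto_intros r_lim)
      then have "(\<lambda>i. F (of_real (r i) * cis (2 * pi * t))) \<longlonglongrightarrow> F (cis (2 * pi * t))"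
        unfolding F_def using w(2) by (intro tendsto_intros) auto
      also have "F (cis (2 * pi * t)) = cis (- a * cot (pi * t))"
        unfolding F_def w(1) by (simp add: cis_conv_exp mult_ac)
      finally show ?case .
    qed
    show "AE t in unit_interval_measure. norm (F (of_real (r i) * cis (2 * pi * t))) \<le> 1" for i
      using r[of i] by (intro AE_I2 F_bound) (simp add: norm_mult)
  qed (auto intro: meas)
  moreover have "(LINT t|unit_interval_measure. F (of_real (r i) * cis (2 * pi * t))) = of_real (exp (- a))" for i
  proof -
    have "F holomorphic_on cball 0 (r i)"
      unfolding F_def using r[of i] by (intro holomorphic_intros) auto
    then have "(LINT t|unit_interval_measure. F (of_real (r i) * cis (2 * pi * t))) = F 0"
      by (rule holomorphic_mean_value[OF _ r(1)])
    then show ?thesis by (simp add: F_def exp_of_real flip: of_real_minus)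
  qed
  ultimately show ?thesis by (simp add: LIMSEQ_const_iff)
qed

lemma integral_cis_cot: "(LINT t|unit_interval_measure. cis (a * cot (pi * t))) = of_real (exp (- \<bar>a\<bar>))"
proof (cases "a \<le> 0")
  case True
  then show ?thesis using integral_cis_cot_nonneg[of "- a"] by simp
next
  case False
  have "(LINT t|unit_interval_measure. cis (a * cot (pi * t))) =
      (LINT t|unit_interval_measure. cnj (cis (- a * cot (pi * t))))"
    by (simp add: cis_cnj)
  also have "\<dots> = cnj (of_real (exp (- a)))"
    using False integral_cis_cot_nonneg[of a] by (simp only: Bochner_Integration.integral_cnj)
  finally show ?thesis using False by simp
qed

lemma prod_cis: "(\<Prod>k\<in>K. cis (g k)) = cis (\<Sum>k\<in>K. g k)"
  by (induction K rule: infinite_finite_induct) (auto simp: cis_mult)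

text \<open>The one-parameter subgroup \<open>s \<mapsto> (p\<^sub>k\<^sup>i\<^sup>s)\<^sub>k\<close> of the torus, on which \<open>character n\<close> has the frequency \<open>tau n\<close>.\<close>
definition kronecker_flow :: "real \<Rightarrow> nat \<Rightarrow> complex" where
  "kronecker_flow s = (\<lambda>k. cis (s * ln (real (nth_prime k))))"

lemma character_kronecker_flow: "character n (kronecker_flow s) = cis (s * tau n)"
  by (simp add: character_def kronecker_flow_def cis_power_int prod_cis tau_def sum_distrib_left mult_ac)

text \<open>The Poisson measure of a finite parameter \<open>s\<close> is the image of the Cauchy distribution with scale \<open>s\<close>, whose
characteristic function is \<open>exp (- s \<bar>a\<bar>)\<close>, under the one-parameter subgroup.\<close>
definition cauchy_on_flow :: "real \<Rightarrow> (nat \<Rightarrow> complex) measure" where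
  "cauchy_on_flow s = distr unit_interval_measure torus_borel (\<lambda>t. kronecker_flow (s * cot (pi * t)))"

lemma cauchy_on_flow:
  assumes "s \<ge> 0"
  shows "sets (cauchy_on_flow s) = sets torus_borel" "prob_space (cauchy_on_flow s)"
    "fourier_measure (cauchy_on_flow s) n = of_real (exp (- s * \<bar>tau n\<bar>))"
proof -
  have cot: "(\<lambda>t. cot (pi * t)) \<in> borel_measurable unit_interval_measure"
    unfolding cot_def by measurable
  have g: "(\<lambda>t. kronecker_flow (s * cot (pi * t))) \<in> measurable unit_interval_measure torus_borel"
    unfolding torus_borel_def
  proof (rule measurable_restrict_space2)
    show "(\<lambda>t. kronecker_flow (s * cot (pi * t))) \<in> borel_measurable unit_interval_measure"
      unfolding kronecker_flow_def
      by (intro measurable_coordinatewise_then_product borel_measurable_continuous_on[OF _ cot, where f="\<lambda>u. cis (s * u * c)" for c])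
         (auto simp: cis_conv_exp intro!: continuous_intros)
  qed (auto simp: torus_def kronecker_flow_def)
  show "sets (cauchy_on_flow s) = sets torus_borel" by (simp add: cauchy_on_flow_def)
  show "prob_space (cauchy_on_flow s)"
    unfolding cauchy_on_flow_def by (rule prob_space.prob_space_distr[OF prob_space_unit_interval_measure g])
  have "fourier_measure (cauchy_on_flow s) n
      = (LINT t|unit_interval_measure. cnj (character n (kronecker_flow (s * cot (pi * t)))))"
    unfolding fourier_measure_def cauchy_on_flow_def
    by (intro integral_distr_torus[OF g] continuous_intros continuous_on_character)
  also have "\<dots> = (LINT t|unit_interval_measure. cis ((- s * tau n) * cot (pi * t)))"
    by (simp add: character_kronecker_flow cis_cnj mult_ac)
  also have "\<dots> = of_real (exp (- s * \<bar>tau n\<bar>))"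
    unfolding integral_cis_cot using assms by (simp add: abs_mult)
  finally show "fourier_measure (cauchy_on_flow s) n = of_real (exp (- s * \<bar>tau n\<bar>))" .
qed

lemma poisson:
  shows "sets (poisson \<sigma>) = sets torus_borel" "prob_space (poisson \<sigma>)"
    "fourier_measure (poisson \<sigma>) n = of_real (poisson_coeff \<sigma> n)"
proof -
  define Q where "Q = (if \<sigma> = \<infinity> then haar else cauchy_on_flow (enn2real \<sigma>))"
  have Q: "sets Q = sets torus_borel" "prob_space Q"
    "fourier_measure Q n = of_real (poisson_coeff \<sigma> n)" for n
    using haar(1,2) haar(3)[of n] fourier_measure_0[OF haar(2)]
      cauchy_on_flow[OF enn2real_nonneg, of \<sigma>]
    by (auto simp: Q_def poisson_coeff_def)
  have "poisson \<sigma> = Q"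
    unfolding poisson_def
  proof (rule the_equality)
    show "sets Q = sets torus_borel \<and> finite_measure Q \<and>
        (\<forall>n. fourier_measure Q n = complex_of_real (poisson_coeff \<sigma> n))"
      using Q by (auto simp: prob_space_def)
    fix M assume "sets M = sets torus_borel \<and> finite_measure M \<and>
        (\<forall>n. fourier_measure M n = complex_of_real (poisson_coeff \<sigma> n))"
    then show "M = Q"
      using Q by (intro torus_measure_eq_if_fourier_measure_eq) (auto simp: prob_space_def)
  qed
  then show "sets (poisson \<sigma>) = sets torus_borel" "prob_space (poisson \<sigma>)"
    "fourier_measure (poisson \<sigma>) n = of_real (poisson_coeff \<sigma> n)"
    using Q by simp_all
qed

lemma poisson_translate:
  assumes l: "l \<in> torus"
  shows "sets (poisson_translate \<sigma> l) = sets torus_borel" "prob_space (poisson_translate \<sigma> l)"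
    "(LINT x|poisson_translate \<sigma> l. character n x) = character n l * of_real (poisson_coeff \<sigma> n)"
proof -
  have g: "(\<lambda>x. x \<odot> l) \<in> measurable (poisson \<sigma>) torus_borel"
    using measurable_seq_mult_torus[OF l poisson(1)] by (simp add: seq_mult_commute)
  show "sets (poisson_translate \<sigma> l) = sets torus_borel" by (simp add: poisson_translate_def)
  show "prob_space (poisson_translate \<sigma> l)"
    unfolding poisson_translate_def by (rule prob_space.prob_space_distr[OF poisson(2) g])
  have "(LINT x|poisson_translate \<sigma> l. character n x) = (LINT x|poisson \<sigma>. character n (x \<odot> l))"
    unfolding poisson_translate_def by (intro integral_distr_torus g continuous_on_character)
  also have "\<dots> = character n l * (LINT x|poisson \<sigma>. character n x)"
    by (simp add: character_seq_mult mult.commute)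
  also have "(LINT x|poisson \<sigma>. character n x) = of_real (poisson_coeff \<sigma> n)"
    by (simp add: integral_character_eq_fourier_measure poisson poisson_coeff_def tau_uminus)
  finally show "(LINT x|poisson_translate \<sigma> l. character n x) = character n l * of_real (poisson_coeff \<sigma> n)" .
qed

text \<open>At nonnegative frequencies the absolute value in the Poisson coefficients disappears and they become the
values of the characters at \<open>p\<^sup>-\<^sup>\<sigma>\<close>. This is the link between Poisson measures and points.\<close>
lemma character_p_neg_pow:
  assumes "tau n \<ge> 0"
  shows "character n (p_neg_pow \<sigma>) = of_real (poisson_coeff \<sigma> n)"
proof (cases "\<sigma> = \<infinity>")
  case True
  then have "p_neg_pow \<sigma> = (\<lambda>_. 0)" by (simp add: p_neg_pow_def fun_eq_iff)
  then show ?thesis using True by (simp add: character_zero_seq poisson_coeff_def)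
next
  case False
  let ?s = "enn2real \<sigma>"
  have "p_neg_pow \<sigma> k = of_real (exp (- ?s * ln (real (nth_prime k))))" for k
    using False prime_gt_0_nat[OF prime_nth_prime[of k]] by (simp add: p_neg_pow_def powr_def)
  then have "character n (p_neg_pow \<sigma>) =
      (\<Prod>k\<in>Poly_Mapping.keys n. of_real (exp (of_int (Poly_Mapping.lookup n k) * (- ?s * ln (real (nth_prime k))))))"
    unfolding character_def by (simp only: exp_power_int flip: of_real_power_int)
  also have "\<dots> = of_real (exp (\<Sum>k\<in>Poly_Mapping.keys n. of_int (Poly_Mapping.lookup n k) * (- ?s * ln (real (nth_prime k)))))"
    by (simp only: exp_sum[OF finite_keys] of_real_prod)
  also have "(\<Sum>k\<in>Poly_Mapping.keys n. of_int (Poly_Mapping.lookup n k) * (- ?s * ln (real (nth_prime k)))) = - ?s * tau n"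
    unfolding tau_def sum_distrib_left by (intro sum.cong) auto
  finally show ?thesis using False assms by (simp add: poisson_coeff_def)
qed

section \<open>Poisson functionals are homomorphisms\<close>

text \<open>For \<open>\<sigma> = \<infinity>\<close> this holds because a sum of two nonnegative frequencies is \<open>0\<close> only if both
summands are, \<open>tau\<close> being injective.\<close>
lemma poisson_coeff_add:
  assumes "tau n \<ge> 0" "tau m \<ge> 0"
  shows "poisson_coeff \<sigma> (n + m) = poisson_coeff \<sigma> n * poisson_coeff \<sigma> m"
proof (cases "\<sigma> = \<infinity>")
  case True
  have "n + m = 0 \<longleftrightarrow> n = 0 \<and> m = 0"
    using assms tau_eq_0_iff[of "n + m"] tau_eq_0_iff[of n] tau_eq_0_iff[of m]
    by (auto simp: tau_add)
  then show ?thesis using True by (simp add: poisson_coeff_def)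
next
  case False
  then show ?thesis using assms by (simp add: poisson_coeff_def tau_add algebra_simps flip: exp_add)
qed

locale poisson_point =
  fixes \<sigma> :: ennreal and l :: "nat \<Rightarrow> complex"
  assumes l: "l \<in> torus"
begin

abbreviation P where "P \<equiv> poisson_translate \<sigma> l"

lemma sets_P: "sets P = sets torus_borel" and prob_space_P: "prob_space P"
  using poisson_translate l by auto

lemma finite_measure_P: "finite_measure P"
  using prob_space_P by (simp add: prob_space_def)

lemma integrable_P: "continuous_on torus f \<Longrightarrow> integrable P (f :: _ \<Rightarrow> complex)"
  using continuous_torus_integrable finite_measure_P sets_P by blast

lemma integral_P_cong: "(\<And>x. x \<in> torus \<Longrightarrow> f x = g x) \<Longrightarrow> (LINT x|P. f x) = (LINT x|P. g x :: complex)"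
  by (intro Bochner_Integration.integral_cong refl) (simp add: space_torus_measure[OF sets_P])

lemma integral_P_close:
  assumes "continuous_on torus f" "continuous_on torus g" "\<And>x. x \<in> torus \<Longrightarrow> cmod (f x - g x) \<le> e"
  shows "cmod ((LINT x|P. f x) - (LINT x|P. g x)) \<le> e"
  using integral_torus_close[OF finite_measure_P sets_P assms] measure_torus_prob[OF prob_space_P sets_P]
  by simp

lemma integral_P_mult_trig_poly:
  assumes "trig_poly nonneg_freqs p" "trig_poly nonneg_freqs q"
  shows "(LINT x|P. p x * q x) = (LINT x|P. p x) * (LINT x|P. q x)"
  using assms
proof (induction arbitrary: q rule: trig_poly.induct)
  case (monomial n c)
  from monomial(2) show ?case
  proof (induction rule: trig_poly.induct)
    case (monomial m d)
    have "(LINT x|P. c * character n x * (d * character m x)) = (LINT x|P. (c * d) * character (n + m) x)"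
      by (rule integral_P_cong) (simp add: character_add torus_nonzero)
    also have "\<dots> = (c * d) * (character n l * character m l * of_real (poisson_coeff \<sigma> n * poisson_coeff \<sigma> m))"
      using \<open>n \<in> nonneg_freqs\<close> monomial l
      by (simp add: poisson_translate poisson_coeff_add character_add torus_nonzero)
    finally show ?case by (simp add: poisson_translate[OF l])
  next
    case (add q1 q2)
    have "continuous_on torus q1" "continuous_on torus q2"
      using add.hyps trig_poly_continuous by blast+
    moreover from this have "continuous_on torus (\<lambda>x. c * character n x * q1 x)"
      "continuous_on torus (\<lambda>x. c * character n x * q2 x)"
      by (auto intro!: continuous_intros continuous_on_character)
    ultimately show ?case using add.IH by (simp add: integrable_P distrib_left)
  next
    case (cong q1 q2)
    have "(LINT x|P. c * character n x * q2 x) = (LINT x|P. c * character n x * q1 x)"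
      by (rule integral_P_cong) (simp add: cong.hyps)
    moreover have "(LINT x|P. q2 x) = (LINT x|P. q1 x)"
      by (rule integral_P_cong) (simp add: cong.hyps)
    ultimately show ?case using cong.IH by simp
  qed
next
  case (add p1 p2)
  have "continuous_on torus p1" "continuous_on torus p2" "continuous_on torus q"
    using add.hyps add.prems trig_poly_continuous by blast+
  then show ?case using add.IH[OF add.prems] by (simp add: integrable_P continuous_on_mult distrib_right)
next
  case (cong p1 p2)
  have "(LINT x|P. p2 x * q x) = (LINT x|P. p1 x * q x)"
    by (rule integral_P_cong) (simp add: cong.hyps)
  moreover have "(LINT x|P. p2 x) = (LINT x|P. p1 x)"
    by (rule integral_P_cong) (simp add: cong.hyps)
  ultimately show ?case using cong.IH[OF cong.prems] by simp
qed

lemma integral_P_mult: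
  assumes f: "f \<in> A_tau" and g: "g \<in> A_tau"
  shows "(LINT x|P. f x * g x) = (LINT x|P. f x) * (LINT x|P. g x)"
proof -
  let ?E = "\<lambda>h. LINT x|P. h x :: complex"
  let ?d = "cmod (?E (\<lambda>x. f x * g x) - ?E f * ?E g)"
  have cont: "continuous_on torus f" "continuous_on torus g" using f g by (auto simp: A_tau_def)
  (* Capping the defect at 1 makes the bound trivial for e > 1; below 1 the norm of the integral
     of q is controlled by that of g. *)
  have "min ?d 1 \<le> e * (2 + cmod (?E f) + cmod (?E g))" if "e > 0" for e
  proof (cases "e \<le> 1")
    case True
    obtain p q where p: "trig_poly nonneg_freqs p" and q: "trig_poly nonneg_freqs q"
      and le: "\<And>x. x \<in> torus \<Longrightarrow> cmod (f x - p x) \<le> e" "\<And>x. x \<in> torus \<Longrightarrow> cmod (g x - q x) \<le> e"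
        "\<And>x. x \<in> torus \<Longrightarrow> cmod (f x * g x - p x * q x) \<le> e"
      using A_tau_approx_product[OF f g \<open>e > 0\<close>] by metis
    note pq = trig_poly_continuous[OF p] trig_poly_continuous[OF q]
    have 1: "cmod (?E f - ?E p) \<le> e" and 2: "cmod (?E g - ?E q) \<le> e"
      and 3: "cmod (?E (\<lambda>x. f x * g x) - ?E (\<lambda>x. p x * q x)) \<le> e"
      by (intro integral_P_close le continuous_on_mult pq cont; assumption)+
    have 4: "cmod (?E q) \<le> cmod (?E g) + 1"
      using norm_triangle_sub[of "?E q" "?E g"] 2 True by (simp add: norm_minus_commute)
    have "?E f * ?E g - ?E p * ?E q = (?E f - ?E p) * ?E q + ?E f * (?E g - ?E q)"
      by (simp add: algebra_simps)
    then have "cmod (?E f * ?E g - ?E p * ?E q) \<le> cmod (?E f - ?E p) * cmod (?E q) + cmod (?E f) * cmod (?E g - ?E q)"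
      by (metis norm_mult norm_triangle_ineq)
    also have "\<dots> \<le> e * (cmod (?E g) + 1) + cmod (?E f) * e"
      using 1 2 4 \<open>e > 0\<close> by (intro add_mono mult_mono) auto
    finally have 5: "cmod (?E f * ?E g - ?E p * ?E q) \<le> e * (cmod (?E g) + 1) + cmod (?E f) * e" .
    have "?d \<le> cmod (?E (\<lambda>x. f x * g x) - ?E (\<lambda>x. p x * q x)) + cmod (?E f * ?E g - ?E p * ?E q)"
      unfolding integral_P_mult_trig_poly[OF p q]
      using norm_triangle_ineq4[of "?E (\<lambda>x. f x * g x) - ?E p * ?E q" "?E f * ?E g - ?E p * ?E q"]
      by simp
    also have "\<dots> \<le> e * (2 + cmod (?E f) + cmod (?E g))"
      using 3 5 by (simp add: algebra_simps)
    finally show ?thesis by linarith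
  next
    case False
    have "1 \<le> e * 1" using False by simp
    also have "\<dots> \<le> e * (2 + cmod (?E f) + cmod (?E g))"
      using False norm_ge_zero[of "?E f"] norm_ge_zero[of "?E g"] by (intro mult_left_mono) linarith+
    finally show ?thesis by linarith
  qed
  then have "min ?d 1 \<le> 0" by (rule nonpos_if_le_small_multiples)
  then show ?thesis by (simp add: min_le_iff_disj)
qed

lemma poisson_functional_eq: "f \<in> A_tau \<Longrightarrow> poisson_functional \<sigma> l f = (LINT x|P. f x)"
  by (simp add: poisson_functional_def)

lemma poisson_functional_hom: "poisson_functional \<sigma> l \<in> complex_homs torus A_tau"
proof -
  let ?\<phi> = "poisson_functional \<sigma> l"
  note eq = poisson_functional_eq
  have int: "integrable P f" if "f \<in> A_tau" for f
    using that by (intro integrable_P) (simp add: A_tau_def)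
  have "?\<phi> (\<lambda>x\<in>torus. 1) = (LINT x|P. 1)"
    unfolding eq[OF A_tau_const] by (rule integral_P_cong) simp
  then have "?\<phi> (\<lambda>x\<in>torus. 1) \<noteq> 0"
    using prob_space.prob_space[OF prob_space_P] by simp
  then have nz: "\<exists>f\<in>A_tau. ?\<phi> f \<noteq> 0" using A_tau_const by blast
  have add: "?\<phi> (\<lambda>x\<in>torus. f x + g x) = ?\<phi> f + ?\<phi> g" if f: "f \<in> A_tau" and g: "g \<in> A_tau" for f g
  proof -
    have "?\<phi> (\<lambda>x\<in>torus. f x + g x) = (LINT x|P. f x + g x)"
      unfolding eq[OF A_tau_add[OF f g]] by (rule integral_P_cong) simp
    then show ?thesis using int f g by (simp add: eq)
  qed
  have scale: "?\<phi> (\<lambda>x\<in>torus. c * f x) = c * ?\<phi> f" if f: "f \<in> A_tau" for c f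
  proof -
    have "?\<phi> (\<lambda>x\<in>torus. c * f x) = (LINT x|P. c * f x)"
      unfolding eq[OF A_tau_scale[OF f]] by (rule integral_P_cong) simp
    then show ?thesis using f by (simp add: eq)
  qed
  have mult: "?\<phi> (\<lambda>x\<in>torus. f x * g x) = ?\<phi> f * ?\<phi> g" if f: "f \<in> A_tau" and g: "g \<in> A_tau" for f g
  proof -
    have "?\<phi> (\<lambda>x\<in>torus. f x * g x) = (LINT x|P. f x * g x)"
      unfolding eq[OF A_tau_mult[OF f g]] by (rule integral_P_cong) simp
    then show ?thesis using f g by (simp add: eq integral_P_mult)
  qed
  have "?\<phi> \<in> extensional A_tau" by (simp add: poisson_functional_def)
  then show ?thesis using nz add scale mult by (simp add: complex_homs_def)
qed

lemma poisson_functional_character: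
  assumes "0 \<le> tau n"
  shows "poisson_functional \<sigma> l (\<lambda>x\<in>torus. character n x) = character n (p_neg_pow \<sigma> \<odot> l)"
proof -
  have "trig_poly nonneg_freqs (\<lambda>x. 1 * character n x)"
    using assms by (intro trig_poly.monomial) simp
  then have A: "(\<lambda>x\<in>torus. character n x) \<in> A_tau" using trig_poly_in_A_tau by simp
  have "poisson_functional \<sigma> l (\<lambda>x\<in>torus. character n x) = (LINT x|P. character n x)"
    unfolding poisson_functional_eq[OF A] by (rule integral_P_cong) simp
  then show ?thesis
    by (simp add: poisson_translate[OF l] character_seq_mult character_p_neg_pow[OF assms])
qed

end

section \<open>Complex homomorphisms are bounded\<close>

lemma character_in_A_tau: "0 \<le> tau n \<Longrightarrow> (\<lambda>x\<in>torus. character n x) \<in> A_tau"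
  using trig_poly_in_A_tau[OF trig_poly.monomial[of n nonneg_freqs 1]] by simp

lemma A_tau_extensional: "f \<in> A_tau \<Longrightarrow> f \<in> extensional torus"
  by (simp add: A_tau_def)

text \<open>The partial sums of the geometric series lie in the algebra and converge uniformly on the torus.\<close>
lemma A_tau_geometric_series:
  assumes f: "f \<in> A_tau" and r: "\<And>x. x \<in> torus \<Longrightarrow> cmod (f x) \<le> r" "r < 1"
  shows "(\<lambda>x\<in>torus. 1 / (1 - f x)) \<in> A_tau"
proof (rule A_tau_if_approximable)
  have cont: "continuous_on torus f" using f by (simp add: A_tau_def)
  have "r \<ge> 0" using r(1)[OF torus_one] norm_ge_zero[of "f torus_one"] by linarith
  have ne: "f x \<noteq> 1" if "x \<in> torus" for x using r(1)[OF that] r(2) by auto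
  have "continuous_on torus (\<lambda>x\<in>torus. 1 / (1 - f x)) = continuous_on torus (\<lambda>x. 1 / (1 - f x))"
    by (rule continuous_on_cong) auto
  then show "continuous_on torus (\<lambda>x\<in>torus. 1 / (1 - f x))"
    using ne by (auto intro!: continuous_intros cont)
  let ?s = "\<lambda>N. \<lambda>x\<in>torus. \<Sum>k<N. f x ^ k"
  have s: "?s N \<in> A_tau" for N
  proof (induction N)
    case 0
    show ?case using A_tau_const[of 0] by (simp only: lessThan_0 sum.empty)
  next
    case (Suc N)
    have "?s (Suc N) = (\<lambda>x\<in>torus. (\<lambda>x\<in>torus. 1) x + (\<lambda>x\<in>torus. f x * ?s N x) x)"
      by (auto simp: restrict_def fun_eq_iff sum.lessThan_Suc_shift sum_distrib_left simp del: sum.lessThan_Suc)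
    then show ?case using A_tau_add[OF A_tau_const[of 1] A_tau_mult[OF f Suc.IH]] by (simp only:)
  qed
  fix e :: real assume "e > 0"
  then have "e * (1 - r) > 0" using r(2) by simp
  then obtain N where N: "r ^ N < e * (1 - r)" using real_arch_pow_inv r(2) by blast
  have "cmod ((\<lambda>x\<in>torus. 1 / (1 - f x)) x - ?s N x) \<le> e" if x: "x \<in> torus" for x
  proof -
    have "1 / (1 - f x) - (\<Sum>k<N. f x ^ k) = f x ^ N / (1 - f x)"
      using ne[OF x] by (simp add: sum_gp_strict diff_divide_distrib)
    moreover have "cmod (1 - f x) \<ge> 1 - r"
      using norm_triangle_ineq2[of 1 "f x"] r(1)[OF x] by simp
    moreover have "cmod (f x ^ N) \<le> r ^ N"
      using r(1)[OF x] by (simp add: norm_power power_mono)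
    ultimately have "cmod (1 / (1 - f x) - (\<Sum>k<N. f x ^ k)) \<le> r ^ N / (1 - r)"
      using r(2) \<open>r \<ge> 0\<close> by (simp add: norm_divide frac_le)
    also have "\<dots> \<le> e" using N r(2) by (simp add: field_simps)
    finally show ?thesis using x by simp
  qed
  then show "\<exists>g. continuous_on torus g \<and> (\<forall>n. tau n < 0 \<longrightarrow> fourier_fun g n = 0) \<and>
      (\<forall>x\<in>torus. cmod ((\<lambda>x\<in>torus. 1 / (1 - f x)) x - g x) \<le> e)"
    using s[of N] by (intro exI[of _ "?s N"]) (auto simp: A_tau_def)
qed simp

locale A_tau_hom =
  fixes \<phi> :: "((nat \<Rightarrow> complex) \<Rightarrow> complex) \<Rightarrow> complex"
  assumes hom: "\<phi> \<in> complex_homs torus A_tau"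
begin

lemma hom_add: "f \<in> A_tau \<Longrightarrow> g \<in> A_tau \<Longrightarrow> \<phi> (\<lambda>x\<in>torus. f x + g x) = \<phi> f + \<phi> g"
  and hom_scale: "f \<in> A_tau \<Longrightarrow> \<phi> (\<lambda>x\<in>torus. c * f x) = c * \<phi> f"
  and hom_mult: "f \<in> A_tau \<Longrightarrow> g \<in> A_tau \<Longrightarrow> \<phi> (\<lambda>x\<in>torus. f x * g x) = \<phi> f * \<phi> g"
  using hom by (simp_all add: complex_homs_def)

lemma hom_one: "\<phi> (\<lambda>x\<in>torus. 1) = 1"
proof -
  obtain f where f: "f \<in> A_tau" "\<phi> f \<noteq> 0" using hom by (auto simp: complex_homs_def)
  have "(\<lambda>x\<in>torus. (\<lambda>x\<in>torus. 1) x * f x) = f"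
    using A_tau_extensional[OF f(1)] by (auto simp: restrict_def extensional_def)
  then have "\<phi> (\<lambda>x\<in>torus. 1) * \<phi> f = \<phi> f"
    using hom_mult[OF A_tau_const f(1), of 1] by simp
  then show ?thesis using f(2) by simp
qed

text \<open>If \<open>|\<phi> f|\<close> exceeded the supremum of \<open>|f|\<close>, then \<open>1 - f / \<phi> f\<close> would be invertible in the
  algebra by the geometric series, although \<open>\<phi>\<close> maps it to zero.\<close>
lemma hom_bounded:
  assumes f: "f \<in> A_tau" and B: "\<And>x. x \<in> torus \<Longrightarrow> cmod (f x) \<le> B"
  shows "cmod (\<phi> f) \<le> B"
proof (rule ccontr)
  assume gt: "\<not> cmod (\<phi> f) \<le> B"
  have "B \<ge> 0" using B[OF torus_one] norm_ge_zero[of "f torus_one"] by linarith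
  then have "\<phi> f \<noteq> 0" using gt by auto
  define g where "g = (\<lambda>x\<in>torus. inverse (\<phi> f) * f x)"
  define h where "h = (\<lambda>x\<in>torus. 1 / (1 - g x))"
  have g: "g \<in> A_tau" unfolding g_def by (rule A_tau_scale[OF f])
  have \<phi>g: "\<phi> g = 1" unfolding g_def using hom_scale[OF f] \<open>\<phi> f \<noteq> 0\<close> by simp
  have g_le: "cmod (g x) \<le> B / cmod (\<phi> f)" if "x \<in> torus" for x
    using B[OF that] that by (simp add: g_def norm_divide divide_right_mono flip: divide_inverse_commute)
  have lt: "B / cmod (\<phi> f) < 1" using gt \<open>\<phi> f \<noteq> 0\<close> by simp
  have h: "h \<in> A_tau" unfolding h_def by (rule A_tau_geometric_series[OF g g_le lt])
  have "(\<lambda>x\<in>torus. (\<lambda>x\<in>torus. 1) x + (\<lambda>x\<in>torus. g x * h x) x) = h"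
  proof
    fix x
    show "(\<lambda>x\<in>torus. (\<lambda>x\<in>torus. 1) x + (\<lambda>x\<in>torus. g x * h x) x) x = h x"
    proof (cases "x \<in> torus")
      case True
      then have "g x \<noteq> 1" using g_le[OF True] lt by auto
      then show ?thesis using True by (simp add: h_def field_simps)
    qed (simp add: h_def)
  qed
  then have "\<phi> h = 1 + \<phi> g * \<phi> h"
    using hom_add[OF A_tau_const[of 1] A_tau_mult[OF g h]] hom_mult[OF g h] hom_one by simp
  then show False using \<phi>g by simp
qed

lemma hom_close:
  assumes f: "f \<in> A_tau" and g: "g \<in> A_tau" and le: "\<And>x. x \<in> torus \<Longrightarrow> cmod (f x - g x) \<le> e"
  shows "cmod (\<phi> f - \<phi> g) \<le> e"
proof -
  let ?h = "\<lambda>x\<in>torus. f x + (\<lambda>x\<in>torus. -1 * g x) x"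
  have "\<phi> ?h = \<phi> f + -1 * \<phi> g"
    by (simp only: hom_add[OF f A_tau_scale[OF g]] hom_scale[OF g])
  moreover have "cmod (\<phi> ?h) \<le> e"
    using le by (intro hom_bounded A_tau_add f A_tau_scale g) simp
  ultimately show ?thesis by simp
qed

end

text \<open>Homomorphisms are contractions for the uniform norm, and the characters with nonnegative frequencies
span a dense subspace.\<close>
lemma homs_eqI:
  assumes \<phi>: "\<phi> \<in> complex_homs torus A_tau" and \<psi>: "\<psi> \<in> complex_homs torus A_tau"
    and eq: "\<And>n. 0 \<le> tau n \<Longrightarrow> \<phi> (\<lambda>x\<in>torus. character n x) = \<psi> (\<lambda>x\<in>torus. character n x)"
  shows "\<phi> = \<psi>"
proof -
  interpret p: A_tau_hom \<phi> by unfold_locales (rule \<phi>)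
  interpret q: A_tau_hom \<psi> by unfold_locales (rule \<psi>)
  have poly: "\<phi> (\<lambda>x\<in>torus. p x) = \<psi> (\<lambda>x\<in>torus. p x)" if "trig_poly nonneg_freqs p" for p
    using that
  proof (induction rule: trig_poly.induct)
    case (monomial n c)
    then have n: "0 \<le> tau n" by simp
    have r: "(\<lambda>x\<in>torus. c * character n x) = (\<lambda>x\<in>torus. c * (\<lambda>x\<in>torus. character n x) x)"
      by (rule restrict_ext) simp
    show ?case
      unfolding r p.hom_scale[OF character_in_A_tau[OF n]] q.hom_scale[OF character_in_A_tau[OF n]]
      by (simp only: eq[OF n])
  next
    case (add p1 p2)
    have r: "(\<lambda>x\<in>torus. p1 x + p2 x) = (\<lambda>x\<in>torus. (\<lambda>x\<in>torus. p1 x) x + (\<lambda>x\<in>torus. p2 x) x)"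
      by (rule restrict_ext) simp
    show ?case
      unfolding r p.hom_add[OF add.hyps[THEN trig_poly_in_A_tau]] q.hom_add[OF add.hyps[THEN trig_poly_in_A_tau]]
      by (simp only: add.IH)
  next
    case (cong p1 p2)
    have "(\<lambda>x\<in>torus. p1 x) = (\<lambda>x\<in>torus. p2 x)" by (rule restrict_ext) (rule cong.hyps)
    then show ?case using cong.IH by (simp only:)
  qed
  have "\<phi> f = \<psi> f" if f: "f \<in> A_tau" for f
  proof -
    have "cmod (\<phi> f - \<psi> f) \<le> e * 2" if "e > 0" for e
    proof -
      obtain p where p: "trig_poly nonneg_freqs p" "\<And>x. x \<in> torus \<Longrightarrow> cmod (f x - p x) < e"
        using A_tau_approx[OF f \<open>e > 0\<close>] by blast
      have "cmod (f x - (\<lambda>x\<in>torus. p x) x) \<le> e" if "x \<in> torus" for x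
        using p(2)[OF that] that by simp
      then have "cmod (\<phi> f - \<phi> (\<lambda>x\<in>torus. p x)) \<le> e" "cmod (\<psi> f - \<psi> (\<lambda>x\<in>torus. p x)) \<le> e"
        using f trig_poly_in_A_tau[OF p(1)] by (blast intro: p.hom_close q.hom_close)+
      then show ?thesis
        using poly[OF p(1)] norm_triangle_ineq4[of "\<phi> f - \<phi> (\<lambda>x\<in>torus. p x)" "\<psi> f - \<psi> (\<lambda>x\<in>torus. p x)"]
        by simp
    qed
    then have "cmod (\<phi> f - \<psi> f) \<le> 0" by (rule nonpos_if_le_small_multiples)
    then show ?thesis by simp
  qed
  then show ?thesis
    using \<phi> \<psi> by (intro extensionalityI[of _ A_tau]) (auto simp: complex_homs_def)
qed

section \<open>Bounded characters of the semigroup of nonnegative frequencies\<close>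

text \<open>The values of a complex homomorphism at the characters \<open>character n\<close> with \<open>tau n \<ge> 0\<close> form such a
function \<open>u\<close>. The candidate for the corresponding point has the coordinates \<open>u (single k 1)\<close>, called
\<open>z k\<close> below.\<close>
locale bounded_semigroup_character =
  fixes u :: "(nat \<Rightarrow>\<^sub>0 int) \<Rightarrow> complex"
  assumes u_0: "u 0 = 1"
    and u_add: "\<And>n m. 0 \<le> tau n \<Longrightarrow> 0 \<le> tau m \<Longrightarrow> u (n + m) = u n * u m"
    and u_bound: "\<And>n. 0 \<le> tau n \<Longrightarrow> cmod (u n) \<le> 1"
begin

definition z :: "nat \<Rightarrow> complex" where
  "z k = u (Poly_Mapping.single k 1)"

lemma tau_single_one: "tau (Poly_Mapping.single k 1) = ln (real (nth_prime k))"
  by (simp add: tau_single)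

lemma norm_z_le: "cmod (z k) \<le> 1"
  unfolding z_def using ln_nth_prime_pos[of k] by (intro u_bound) (simp add: tau_single_one)

lemma u_multiple: "0 \<le> tau n \<Longrightarrow> \<exists>m. tau m = real N * tau n \<and> u m = u n ^ N"
proof (induction N)
  case 0
  then show ?case using u_0 by (intro exI[of _ 0]) simp
next
  case (Suc N)
  then obtain m where "tau m = real N * tau n" "u m = u n ^ N" by auto
  then show ?case
    using Suc.prems u_add[of n m] by (intro exI[of _ "n + m"]) (simp add: tau_add algebra_simps)
qed

text \<open>A zero propagates from one frequency to all others, because some multiple of any nonzero frequency
  exceeds a given one.\<close>
lemma u_vanishes:
  assumes "z k = 0" "0 \<le> tau n" "n \<noteq> 0"
  shows "u n = 0"
proof -
  let ?e = "Poly_Mapping.single k 1"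
  have "tau n > 0" using assms(2,3) tau_eq_0_iff[of n] by linarith
  then obtain N where N: "tau ?e < real N * tau n" using reals_Archimedean3 by blast
  obtain m where m: "tau m = real N * tau n" "u m = u n ^ N" using u_multiple[OF assms(2)] by blast
  have "u m = u (?e + (m - ?e))" by simp
  also have "\<dots> = z k * u (m - ?e)"
    unfolding z_def using N m(1) ln_nth_prime_pos[of k]
    by (intro u_add) (simp_all add: tau_diff tau_single_one)
  finally show ?thesis using m(2) assms(1) by simp
qed

text \<open>The frequencies at which \<open>u\<close> agrees with evaluation at \<open>z\<close> form a semigroup that contains the unit vectors.
Every frequency is a difference of two of them, and since \<open>z\<close> has no zero coordinate one may divide.\<close>
lemma u_eq_character:
  assumes nz: "\<And>k. z k \<noteq> 0" and n: "0 \<le> tau n"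
  shows "u n = character n z"
proof -
  define T where "T = {a. 0 \<le> tau a \<and> u a = character a z}"
  have T_add: "a + b \<in> T" if "a \<in> T" "b \<in> T" for a b
    using that u_add[of a b] character_add[of z a b] nz by (simp add: T_def tau_add)
  have "\<exists>a\<in>T. \<exists>b\<in>T. n = a - b" for n
    using subset_UNIV[of "Poly_Mapping.keys n"]
  proof (induction rule: frag_induction)
    case zero
    show ?case using u_0 by (intro bexI[of _ 0]) (auto simp: T_def)
  next
    case (one k)
    have "frag_of k \<in> T"
      using ln_nth_prime_pos[of k] by (simp add: T_def tau_single_one z_def)
    then show ?case using u_0 by (intro bexI[of _ "frag_of k"] bexI[of _ 0]) (auto simp: T_def)
  next
    case (diff n m)
    then obtain a b c d where "a \<in> T" "b \<in> T" "c \<in> T" "d \<in> T" "n = a - b" "m = c - d" by blast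
    then show ?case
      by (intro bexI[of _ "a + d"] bexI[of _ "b + c"]) (auto intro: T_add)
  qed
  then obtain a b where ab: "a \<in> T" "b \<in> T" "n = a - b" by blast
  then have "u n * character b z = character n z * character b z"
    using u_add[OF n, of b] character_add[of z n b] nz by (simp add: T_def)
  then show ?thesis using character_nonzero[of z b] nz by simp
qed

text \<open>Archimedean comparison: whenever \<open>N log p\<^sub>j \<le> a log p\<^sub>k\<close>, the frequency \<open>a e\<^sub>k - N e\<^sub>j\<close> is
  nonnegative and so \<open>|z\<^sub>k|^a \<le> |z\<^sub>j|^N\<close>. Taking \<open>a / N\<close> down to \<open>log p\<^sub>j / log p\<^sub>k\<close> compares the two logarithms.\<close>
lemma log_norm_comparison:
  assumes nz: "\<And>k. z k \<noteq> 0"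
  shows "- ln (cmod (z j)) * ln (real (nth_prime k)) \<le> - ln (cmod (z k)) * ln (real (nth_prime j))"
proof -
  define v where "v = (\<lambda>k. - ln (cmod (z k)))"
  define L where "L = (\<lambda>k. ln (real (nth_prime k)))"
  have L: "L k > 0" for k unfolding L_def by (rule ln_nth_prime_pos)
  have v: "v k \<ge> 0" for k
    unfolding v_def using norm_z_le[of k] nz[of k] by simp
  have step: "real N * (v j - L j / L k * v k) \<le> v k" for N
  proof -
    define a where "a = nat \<lceil>real N * L j / L k\<rceil>"
    have "real N * L j / L k \<ge> 0" using L[of j] L[of k] by simp
    then have a: "real N * L j / L k \<le> real a" "real a \<le> real N * L j / L k + 1"
      unfolding a_def by linarith+
    let ?n = "Poly_Mapping.single k (int a) - Poly_Mapping.single j (int N)"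
    have "tau ?n \<ge> 0"
      using a(1) L[of k] by (simp add: tau_diff tau_single L_def field_simps)
    then have "cmod (character ?n z) \<le> 1"
      using u_bound u_eq_character[OF nz] by simp
    then have "cmod (z k) ^ a \<le> cmod (z j) ^ N"
      using nz[of j] by (simp add: character_diff[OF nz] norm_divide norm_power divide_le_eq)
    then have "ln (cmod (z k) ^ a) \<le> ln (cmod (z j) ^ N)"
      using nz by simp
    then have "real N * v j \<le> real a * v k"
      using nz by (simp add: ln_realpow v_def)
    also have "\<dots> \<le> (real N * L j / L k + 1) * v k"
      using a(2) v[of k] by (intro mult_right_mono)
    finally show ?thesis by (simp add: algebra_simps)
  qed
  have "v j - L j / L k * v k \<le> 0"
  proof (rule ccontr)
    assume "\<not> ?thesis"
    then have "v j - L j / L k * v k > 0" by simp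
    then obtain N where "v k < real N * (v j - L j / L k * v k)" using reals_Archimedean3 by blast
    then show False using step[of N] by simp
  qed
  then have "v j * L k \<le> v k * L j" using L[of k] by (simp add: field_simps)
  then show ?thesis by (simp add: v_def L_def)
qed

text \<open>If some coordinate of \<open>z\<close> is zero, then \<open>u\<close> vanishes off \<open>0\<close> and the point is the one with \<open>\<sigma> = \<infinity>\<close>.
Otherwise \<open>log \<bar>z\<^sub>k\<bar>\<close> is proportional to \<open>log p\<^sub>k\<close>; the factor is \<open>- \<sigma>\<close>, and the phases
of \<open>z\<close> make up \<open>l\<close>.\<close>
lemma representation:
  obtains \<sigma> l where "l \<in> torus" "\<And>n. 0 \<le> tau n \<Longrightarrow> u n = character n (p_neg_pow \<sigma> \<odot> l)"
proof (cases "\<exists>k. z k = 0")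
  case True
  have "p_neg_pow \<infinity> \<odot> torus_one = (\<lambda>_. 0)"
    by (simp add: p_neg_pow_def seq_mult_def)
  then show ?thesis
    using True u_vanishes u_0 that[OF torus_one, of \<infinity>] by (auto simp: character_zero_seq)
next
  case False
  then have nz: "z k \<noteq> 0" for k by blast
  let ?L = "\<lambda>k. ln (real (nth_prime k))"
  define s where "s = - ln (cmod (z 0)) / ?L 0"
  define l where "l = (\<lambda>k. z k / of_real (cmod (z k)))"
  have "s \<ge> 0" unfolding s_def using norm_z_le[of 0] nz[of 0] ln_nth_prime_pos[of 0] by (intro divide_nonneg_pos) simp_all
  have abs_z: "cmod (z k) = real (nth_prime k) powr - s" for k
  proof -
    have "- ln (cmod (z 0)) * ?L k = - ln (cmod (z k)) * ?L 0"
      using log_norm_comparison[OF nz, of 0 k] log_norm_comparison[OF nz, of k 0] by linarith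
    then have "ln (cmod (z k)) = - s * ?L k"
      unfolding s_def using ln_nth_prime_pos[of 0] by (simp add: field_simps)
    then have "cmod (z k) = exp (- s * ?L k)" using nz[of k] by (metis exp_ln zero_less_norm_iff)
    then show ?thesis using prime_gt_0_nat[OF prime_nth_prime[of k]] by (simp add: powr_def)
  qed
  have "p_neg_pow (ennreal s) \<odot> l = z"
    using nz \<open>s \<ge> 0\<close> by (auto simp: p_neg_pow_def seq_mult_def l_def simp flip: abs_z)
  moreover have "l \<in> torus" using nz by (simp add: torus_def l_def norm_divide)
  ultimately show ?thesis using that u_eq_character[OF nz] by metis
qed

end

section \<open>The maximal ideal space\<close>

theorem corollary5p8:
  "(\<forall>\<sigma>. \<forall>l\<in>torus. poisson_functional \<sigma> l \<in> complex_homs torus A_tau) \<and>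
   (\<exists>\<Phi>. (\<forall>\<sigma>. \<forall>l\<in>torus. \<Phi> (p_neg_pow \<sigma> \<odot> l) = poisson_functional \<sigma> l) \<and>
        bij_betw \<Phi> frakD (complex_homs torus A_tau))"
proof -
  (* A point of frakD does not determine the pair of parameters (at 0 every l is possible), so the map is
     defined through the values of the characters, which depend on the point only. *)
  define \<Phi> where "\<Phi> = (\<lambda>z. THE \<phi>. \<phi> \<in> complex_homs torus A_tau \<and>
    (\<forall>n. 0 \<le> tau n \<longrightarrow> \<phi> (\<lambda>x\<in>torus. character n x) = character n z))"
  have hom: "poisson_functional \<sigma> l \<in> complex_homs torus A_tau" if "l \<in> torus" for \<sigma> l
    using that poisson_point.poisson_functional_hom by (simp add: poisson_point_def)
  have char: "poisson_functional \<sigma> l (\<lambda>x\<in>torus. character n x) = character n (p_neg_pow \<sigma> \<odot> l)"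
    if "l \<in> torus" "0 \<le> tau n" for \<sigma> l n
    using that poisson_point.poisson_functional_character by (simp add: poisson_point_def)
  have \<Phi>: "\<Phi> (p_neg_pow \<sigma> \<odot> l) = poisson_functional \<sigma> l" if l: "l \<in> torus" for \<sigma> l
    unfolding \<Phi>_def
  proof (rule the_equality)
    show "poisson_functional \<sigma> l \<in> complex_homs torus A_tau \<and>
      (\<forall>n. 0 \<le> tau n \<longrightarrow> poisson_functional \<sigma> l (\<lambda>x\<in>torus. character n x) = character n (p_neg_pow \<sigma> \<odot> l))"
      using hom[OF l] char[OF l] by blast
    fix \<phi> assume "\<phi> \<in> complex_homs torus A_tau \<and>
      (\<forall>n. 0 \<le> tau n \<longrightarrow> \<phi> (\<lambda>x\<in>torus. character n x) = character n (p_neg_pow \<sigma> \<odot> l))"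
    then show "\<phi> = poisson_functional \<sigma> l"
      by (intro homs_eqI hom[OF l]) (auto simp: char[OF l])
  qed
  have "bij_betw \<Phi> frakD (complex_homs torus A_tau)"
    unfolding bij_betw_def
  proof
    show "inj_on \<Phi> frakD"
    proof (rule inj_onI)
      have coord: "\<Phi> z (\<lambda>x\<in>torus. character (Poly_Mapping.single k 1) x) = z k" if "z \<in> frakD" for z k
      proof -
        have pos: "0 \<le> tau (Poly_Mapping.single k 1)"
          using ln_nth_prime_pos[of k] by (simp add: tau_single)
        obtain \<sigma> l where "l \<in> torus" "z = p_neg_pow \<sigma> \<odot> l" using \<open>z \<in> frakD\<close> by (auto simp: frakD_def)
        then show ?thesis using char[OF _ pos, of l \<sigma>] by (simp add: \<Phi>)
      qed
      fix z w assume "z \<in> frakD" "w \<in> frakD" "\<Phi> z = \<Phi> w"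
      then show "z = w" using coord by (metis ext)
    qed
    show "\<Phi> ` frakD = complex_homs torus A_tau"
    proof (intro equalityI subsetI)
      fix \<phi> assume "\<phi> \<in> \<Phi> ` frakD"
      then show "\<phi> \<in> complex_homs torus A_tau" using \<Phi> hom by (auto simp: frakD_def)
    next
      fix \<phi> assume \<phi>: "\<phi> \<in> complex_homs torus A_tau"
      interpret h: A_tau_hom \<phi> by unfold_locales (rule \<phi>)
      define u where "u = (\<lambda>n. \<phi> (\<lambda>x\<in>torus. character n x))"
      have "bounded_semigroup_character u"
      proof
        have "(\<lambda>x\<in>torus. character 0 x) = (\<lambda>x\<in>torus. 1)" by (rule restrict_ext) simp
        then show "u 0 = 1" by (simp only: u_def h.hom_one)
        show "cmod (u n) \<le> 1" if "0 \<le> tau n" for n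
          unfolding u_def using that by (intro h.hom_bounded character_in_A_tau) (auto simp: norm_character)
        show "u (n + m) = u n * u m" if "0 \<le> tau n" "0 \<le> tau m" for n m
        proof -
          have "(\<lambda>x\<in>torus. character (n + m) x) =
              (\<lambda>x\<in>torus. (\<lambda>x\<in>torus. character n x) x * (\<lambda>x\<in>torus. character m x) x)"
            by (rule restrict_ext) (simp add: character_add torus_nonzero)
          then show ?thesis
            unfolding u_def using h.hom_mult[OF character_in_A_tau[OF that(1)] character_in_A_tau[OF that(2)]]
            by (simp only:)
        qed
      qed
      then obtain \<sigma> l where l: "l \<in> torus" and u: "\<And>n. 0 \<le> tau n \<Longrightarrow> u n = character n (p_neg_pow \<sigma> \<odot> l)"
        using bounded_semigroup_character.representation by metis
      have "\<phi> = poisson_functional \<sigma> l"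
        using u by (intro homs_eqI \<phi> hom[OF l]) (simp add: char[OF l] u_def)
      also have "\<dots> = \<Phi> (p_neg_pow \<sigma> \<odot> l)" using \<Phi>[OF l] by simp
      also have "\<dots> \<in> \<Phi> ` frakD" using l by (auto simp: frakD_def)
      finally show "\<phi> \<in> \<Phi> ` frakD" .
    qed
  qed
  then show ?thesis using hom \<Phi> by blast
qed

end
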